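(* Assume that at least one of the following conditions holds: $(WP_1)$ the lower level set $\{y\in\overline{\mathcal{F}}\mid f(y)\le f(x^0)\}$ is bounded; $(WP_2)$ (i) $\operatorname{dom}h=\overline{C}$ and for all $a\in\overline{C}$ and $\gamma\in\mathbb{R}$ the set $\{y\in\mathcal{F}\mid D_h(a,y)\le\gamma\}$ is bounded, and (ii) $S(P)\ne\emptyset$ and $f$ is quasi-convex (i.e. its lower level sets are convex); $(WP_3)$ there exist $K\ge0$ and $L\in\mathbb{R}$ such that $\|H(x)^{-1}\|\le K|x|+L$ for all $x\in C$. If $\inf_{\mathcal{F}}f>-\infty$, then the dynamical system $(H\text{-}SD)$ $$\dot x(t)+\nabla_Hf_{|\mathcal{F}}(x(t))=0,\quad x(0)=x^0\in\mathcal{F},$$ is well-posed, i.e. its maximal solution $x$, defined on $(T_m,T_M)\ni0$, satisfies $T_M=+\infty$. Consequently, the mapping $t\mapsto f(x(t))$ is nonincreasing and convergent as $t\to+\infty$.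
   Context: Let $m<n$ be positive integers, $A\in\mathbb{R}^{m\times n}$ of full rank, $b\in\operatorname{Im}A$, $\mathcal{A}=\{x\in\mathbb{R}^n: Ax=b\}$, $\mathcal{A}_0=\ker A$. Let $C\subset\mathbb{R}^n$ be nonempty, open and convex, with $\mathcal{F}=C\cap\mathcal{A}\neq\emptyset$ and $\overline{\mathcal{F}}=\overline{C}\cap\mathcal{A}$. The function $f\in\mathcal{C}^1(\mathbb{R}^n)$ has locally Lipschitz continuous gradient $\nabla f$ on $\mathbb{R}^n$. $S(P)$ is the set of optimal solutions of $(P)$: $\inf\{f(x)\mid x\in\overline{C},\ Ax=b\}$. $\Gamma_0(\mathbb{R}^n)$ is the set of lower semicontinuous proper convex functions $\mathbb{R}^n\to\mathbb{R}\cup\{+\infty\}$. A function $h\in\Gamma_0(\mathbb{R}^n)$ is essentially smooth if it is differentiable on $\operatorname{int}\operatorname{dom}h$ and $|\nabla h(x^j)|\to+\infty$ for every sequence $(x^j)\subset\operatorname{int}\operatorname{dom}h$ converging to a boundary point of $\operatorname{dom}h$; it is of Legendre type if moreover it is strictly convex on $\operatorname{int}\operatorname{dom}h$. The function $h\in\Gamma_0(\mathbb{R}^n)$ is assumed to satisfy: (i) $h$ is of Legendre type with $\operatorname{int}\operatorname{dom}h=C$; (ii) $h_{|C}\in\mathcal{C}^2(C;\mathbb{R})$ and $\nabla^2h(x)$ is symmetric positive definite for all $x\in C$; (iii) $x\mapsto\nabla^2h(x)$ is locally Lipschitz continuous on $C$. Set $H=\nabla^2h$ on $C$, and $D_h(x,y)=h(x)-h(y)-\langle\nabla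 h(y),x-y\rangle$ for $x\in\operatorname{dom}h$, $y\in C$. On the submanifold $\mathcal{F}$, with tangent space $\mathcal{A}_0$, consider the Riemannian metric $(u,v)^H_x=\langle H(x)u,v\rangle$; the gradient of $f_{|\mathcal{F}}$ is $\nabla_Hf_{|\mathcal{F}}(x)=H(x)^{-1}[I-A^T(AH(x)^{-1}A^T)^{-1}AH(x)^{-1}]\nabla f(x)$. Boundedness is with respect to the Euclidean norm $|\cdot|$. *)

theory Defs
  imports "HOL-Analysis.Analysis"
begin

section \<open>Gradients, Hessians and regularity\<close>

definition grad :: "('a::real_inner \<Rightarrow> real) \<Rightarrow> 'a \<Rightarrow> 'a" where
  "grad g x = (THE D. GDERIV g x :> D)"

definition hessian :: "(real^'n \<Rightarrow> real) \<Rightarrow> real^'n \<Rightarrow> real^'n^'n" where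
  "hessian g x = jacobian (grad g) (at x)"

text \<open>\<^term>\<open>C1_on\<close> and \<^term>\<open>C2_on\<close> are only meant for open sets: they use derivatives in the
  ambient space.\<close>

definition C1_on :: "'a::real_inner set \<Rightarrow> ('a \<Rightarrow> real) \<Rightarrow> bool" where
  "C1_on U g \<longleftrightarrow> (\<forall>x\<in>U. g differentiable (at x)) \<and> continuous_on U (grad g)"

definition C2_on :: "(real^'n) set \<Rightarrow> (real^'n \<Rightarrow> real) \<Rightarrow> bool" where
  "C2_on U g \<longleftrightarrow>
     C1_on U g \<and> (\<forall>x\<in>U. grad g differentiable (at x)) \<and> continuous_on U (hessian g)"

definition locally_lipschitz_on :: "'a::metric_space set \<Rightarrow> ('a \<Rightarrow> 'b::metric_space) \<Rightarrow> bool" where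
  "locally_lipschitz_on U g \<longleftrightarrow> (\<forall>x\<in>U. \<exists>r>0. \<exists>L. L-lipschitz_on (cball x r \<inter> U) g)"

definition sym_pos_def :: "real^'n^'n \<Rightarrow> bool" where
  "sym_pos_def M \<longleftrightarrow> transpose M = M \<and> (\<forall>v. v \<noteq> 0 \<longrightarrow> 0 < (M *v v) \<bullet> v)"

definition quasi_convex :: "('a::real_vector \<Rightarrow> real) \<Rightarrow> bool" where
  "quasi_convex g \<longleftrightarrow> (\<forall>c. convex {x. g x \<le> c})"

section \<open>Extended-real-valued convex functions\<close>

definition eff_dom :: "('a \<Rightarrow> ereal) \<Rightarrow> 'a set" where
  "eff_dom h = {x. h x < \<infinity>}"

definition Gamma0 :: "('a::real_normed_vector \<Rightarrow> ereal) \<Rightarrow> bool" where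
  "Gamma0 h \<longleftrightarrow>
     (\<forall>x. h x \<noteq> -\<infinity>) \<and> eff_dom h \<noteq> {} \<and>
     (\<forall>x. h x \<le> Liminf (at x) h) \<and>
     (\<forall>x y. \<forall>t\<in>{0<..<1}.
        h ((1 - t) *\<^sub>R x + t *\<^sub>R y) \<le> ereal (1 - t) * h x + ereal t * h y)"

text \<open>The real-valued version of \<open>h\<close>. It is only meaningful on the effective domain, since
  \<^const>\<open>real_of_ereal\<close> sends infinity to 0.\<close>

definition rpart :: "('a \<Rightarrow> ereal) \<Rightarrow> 'a \<Rightarrow> real" where
  "rpart h x = real_of_ereal (h x)"

definition essentially_smooth :: "('a::real_inner \<Rightarrow> ereal) \<Rightarrow> bool" where
  "essentially_smooth h \<longleftrightarrow>
     (\<forall>x\<in>interior (eff_dom h). rpart h differentiable (at x)) \<and>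
     (\<forall>X l. (\<forall>j. X j \<in> interior (eff_dom h)) \<and> X \<longlonglongrightarrow> l \<and> l \<in> frontier (eff_dom h) \<longrightarrow>
        filterlim (\<lambda>j::nat. norm (grad (rpart h) (X j))) at_top sequentially)"

definition strictly_convex_on :: "'a::real_vector set \<Rightarrow> ('a \<Rightarrow> real) \<Rightarrow> bool" where
  "strictly_convex_on U g \<longleftrightarrow>
     (\<forall>x\<in>U. \<forall>y\<in>U. \<forall>t\<in>{0<..<1}. x \<noteq> y \<longrightarrow>
        g ((1 - t) *\<^sub>R x + t *\<^sub>R y) < (1 - t) * g x + t * g y)"

definition legendre_type :: "('a::real_inner \<Rightarrow> ereal) \<Rightarrow> bool" where
  "legendre_type h \<longleftrightarrow>
     essentially_smooth h \<and> strictly_convex_on (interior (eff_dom h)) (rpart h)"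

text \<open>Meaningful for \<open>a\<close> in the effective domain and \<open>y\<close> in its interior.\<close>

definition bregman :: "('a::real_inner \<Rightarrow> ereal) \<Rightarrow> 'a \<Rightarrow> 'a \<Rightarrow> real" where
  "bregman h a y = rpart h a - rpart h y - grad (rpart h) y \<bullet> (a - y)"

section \<open>The Riemannian gradient of the restriction to the affine slice\<close>

definition affine_slice :: "real^'n^'m \<Rightarrow> real^'m \<Rightarrow> (real^'n) set" where
  "affine_slice A b = {x. A *v x = b}"

definition slice_grad :: "real^'n^'m \<Rightarrow> real^'n^'n \<Rightarrow> real^'n \<Rightarrow> real^'n" where
  "slice_grad A M g =
     (matrix_inv M **
       (mat 1 - transpose A ** matrix_inv (A ** matrix_inv M ** transpose A) ** A ** matrix_inv M))
     *v g"

definition riem_grad ::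
  "real^'n^'m \<Rightarrow> (real^'n \<Rightarrow> ereal) \<Rightarrow> (real^'n \<Rightarrow> real) \<Rightarrow> real^'n \<Rightarrow> real^'n" where
  "riem_grad A h f x = slice_grad A (hessian (rpart h) x) (grad f x)"

text \<open>The explicit formula is the Riemannian gradient: the unique tangent vector representing the
  differential \<open>u \<mapsto> g \<bullet> u\<close> on the tangent space \<open>ker A\<close> for the scalar product
  \<open>(u, v) \<mapsto> M u \<bullet> v\<close>.\<close>

lemma sym_pos_def_invertible:
  assumes "sym_pos_def M"
  shows "invertible M"
proof -
  have "\<forall>x. M *v x = 0 \<longrightarrow> x = 0"
    using assms unfolding sym_pos_def_def by (metis inner_zero_left less_irrefl)
  then show ?thesis
    by (simp add: invertible_left_inverse matrix_left_invertible_ker)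
qed

lemma matrix_inv_mult:
  fixes M :: "real^'n^'n"
  assumes "invertible M"
  shows "M ** matrix_inv M = mat 1" "matrix_inv M ** M = mat 1"
proof -
  from assms have "\<exists>N. M ** N = mat 1 \<and> N ** M = mat 1"
    by (simp add: invertible_def)
  then have "M ** matrix_inv M = mat 1 \<and> matrix_inv M ** M = mat 1"
    unfolding matrix_inv_def by (rule someI_ex)
  then show "M ** matrix_inv M = mat 1" "matrix_inv M ** M = mat 1" by auto
qed

lemma slice_grad_iff:
  fixes A :: "real^'n^'m"
  assumes A: "rank A = CARD('m)" and M: "sym_pos_def M"
  shows "v = slice_grad A M g \<longleftrightarrow>
           A *v v = 0 \<and> (\<forall>u. A *v u = 0 \<longrightarrow> (M *v v) \<bullet> u = g \<bullet> u)"
proof -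
  let ?N = "matrix_inv M" and ?T = "transpose A"
  let ?B = "A ** ?N ** ?T"
  let ?w = "slice_grad A M g"
  have MN: "M ** ?N = mat 1"
    using matrix_inv_mult sym_pos_def_invertible[OF M] by auto
  then have MNv: "M *v (?N *v y) = y" for y
    by (simp add: matrix_vector_mul_assoc)
  have adj: "(?T *v y) \<bullet> u = y \<bullet> (A *v u)" for y u
    by (metis dot_lmul_matrix inner_commute transpose_matrix_vector)
  have "surj ((*v) A)"
    using A full_rank_surjective by blast
  then have T0: "y = 0" if "?T *v y = 0" for y
    using that adj by (metis inner_eq_zero_iff inner_zero_left surjD)
  have "y = 0" if "?B *v y = 0" for y
  proof -
    have "0 = y \<bullet> (A *v (?N *v (?T *v y)))"
      using that by (simp add: matrix_vector_mul_assoc matrix_mul_assoc del: transpose_matrix_vector)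
    also have "\<dots> = (?T *v y) \<bullet> (?N *v (?T *v y))"
      by (simp only: adj)
    also have "\<dots> = (M *v (?N *v (?T *v y))) \<bullet> (?N *v (?T *v y))"
      by (simp only: MNv)
    finally have "?N *v (?T *v y) = 0"
      using M unfolding sym_pos_def_def by (metis less_irrefl)
    then have "?T *v y = 0"
      by (metis MNv matrix_vector_mult_0_right)
    then show ?thesis by (rule T0)
  qed
  then have "invertible ?B"
    by (simp add: invertible_left_inverse matrix_left_invertible_ker)
  then have BI: "?B *v (matrix_inv ?B *v y) = y" for y
    by (simp add: matrix_inv_mult matrix_vector_mul_assoc)
  define y where "y = matrix_inv ?B *v (A *v (?N *v g))"
  have w: "?w = ?N *v (g - ?T *v y)"
    by (simp add: slice_grad_def y_def matrix_vector_mul_assoc[symmetric]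
        matrix_vector_mult_diff_rdistrib del: transpose_matrix_vector)
  have Aw: "A *v ?w = 0"
    using BI[of "A *v (?N *v g)"]
    by (simp add: w matrix_vector_mult_diff_distrib y_def matrix_vector_mul_assoc[symmetric]
        del: transpose_matrix_vector)
  have rep: "(M *v ?w) \<bullet> u = g \<bullet> u" if "A *v u = 0" for u
    using that by (simp add: w MNv inner_diff_left adj del: transpose_matrix_vector)
  show ?thesis
  proof
    assume "A *v v = 0 \<and> (\<forall>u. A *v u = 0 \<longrightarrow> (M *v v) \<bullet> u = g \<bullet> u)"
    then have "A *v (v - ?w) = 0" "(M *v (v - ?w)) \<bullet> (v - ?w) = 0"
      using Aw rep by (simp_all add: matrix_vector_mult_diff_distrib inner_diff_left)
    then show "v = ?w"
      using M unfolding sym_pos_def_def by (metis eq_iff_diff_eq_0 less_irrefl)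
  qed (use Aw rep in auto)
qed

section \<open>The initial value problem \<open>x' + V x = 0\<close>, \<open>x 0 = x0\<close> in a set \<open>F\<close>\<close>

definition ivp_solution ::
  "('a::real_normed_vector \<Rightarrow> 'a) \<Rightarrow> 'a set \<Rightarrow> 'a \<Rightarrow> ereal \<Rightarrow> ereal \<Rightarrow> (real \<Rightarrow> 'a) \<Rightarrow> bool" where
  "ivp_solution V F x0 Tm TM x \<longleftrightarrow>
     Tm < 0 \<and> 0 < TM \<and> x 0 = x0 \<and>
     (\<forall>t\<in>einterval Tm TM. x t \<in> F \<and> (x has_vector_derivative - V (x t)) (at t))"

definition maximal_solution ::
  "('a::real_normed_vector \<Rightarrow> 'a) \<Rightarrow> 'a set \<Rightarrow> 'a \<Rightarrow> ereal \<Rightarrow> ereal \<Rightarrow> (real \<Rightarrow> 'a) \<Rightarrow> bool" where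
  "maximal_solution V F x0 Tm TM x \<longleftrightarrow>
     ivp_solution V F x0 Tm TM x \<and>
     (\<forall>Sm SM y. ivp_solution V F x0 Sm SM y \<and> Sm \<le> Tm \<and> TM \<le> SM \<and>
        (\<forall>t\<in>einterval Tm TM. y t = x t) \<longrightarrow> Sm = Tm \<and> SM = TM)"

text \<open>Well-posedness includes existence and uniqueness of the maximal solution; as solutions are
  total functions, uniqueness is only required on the interval of definition.\<close>

definition well_posed :: "('a::real_normed_vector \<Rightarrow> 'a) \<Rightarrow> 'a set \<Rightarrow> 'a \<Rightarrow> bool" where
  "well_posed V F x0 \<longleftrightarrow>
     (\<exists>Tm x. maximal_solution V F x0 Tm \<infinity> x \<and>
        (\<forall>Sm SM y. maximal_solution V F x0 Sm SM y \<longrightarrow>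
           Sm = Tm \<and> SM = \<infinity> \<and> (\<forall>t\<in>einterval Tm \<infinity>. y t = x t)))"

end

(* Well-posedness comes down to excluding blow-up at a finite time T. Since <H x', x'> = -(f(x))', the
   function f decreases along the flow, and each of the three conditions bounds the orbit on [0, T):
   (WP1) directly, (WP2) because the Bregman distance to a minimizer decreases, (WP3) by Gronwall.
   For u in ker A one has <grad h(x), u>' = -<grad f(x), u>, which stays bounded on a bounded orbit;
   monotonicity of grad h then bounds grad h(x(t)) itself. As |grad h| blows up at the boundary
   of C, the orbit has a cluster point in F as t tends to T, and uniform local existence around that point
   continues the solution past T. *)
theory Submission
  imports Defs
begin

text \<open>The slice \<open>F\<close> has empty interior in the ambient space, so Picard's theorem
  does not apply in it: it is applied in the open set \<open>C\<close>, and tangency of the field to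
  ker A keeps the orbits in \<open>F\<close>. The field is given by a formula with two matrix
  inverses. The estimates use instead its variational characterization
  \<open>slice_grad_iff\<close>, which turns coercivity of the Hessian into bounds and Lipschitz
  estimates. The blow-up at the boundary concerns the full gradient of h, while the equation
  controls only its components along ker A. A ball around \<open>x0\<close> inside \<open>C\<close>,
  where monotonicity can be tested in every direction, closes this gap. Under (WP3) the speed is
  bounded by a geometric mean of the growth bound and the dissipation rate. Splitting it by the
  arithmetic-geometric mean inequality leaves a linear term, fit for Gronwall, and a dissipation
  term that the lower bound on f absorbs.\<close>

section \<open>Local existence and uniqueness of solutions\<close>

text \<open>Banach's fixed point theorem in the space of bounded continuous paths on the whole line.
  The integral starts at \<open>-\<delta>\<close>, so that one formula serves both signs of t; each
  of the two integrals in \<open>T\<close> then contributes a factor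
  \<open>2 * \<delta> * L\<close>, whence the constant \<open>4 * \<delta> * L\<close>.\<close>

lemma picard_global:
  fixes W :: "'a::euclidean_space \<Rightarrow> 'a"
  assumes W: "L-lipschitz_on UNIV W" and \<delta>: "\<delta> > 0" "4 * \<delta> * L < 1"
  shows "\<exists>\<phi>. \<phi> 0 = q \<and> (\<forall>t\<in>{-\<delta><..<\<delta>}. (\<phi> has_vector_derivative W (\<phi> t)) (at t))"
proof -
  \<comment> \<open>Clamping the time makes \<open>T u\<close> a bounded path on the whole line, as
    the type of bounded continuous functions demands; inside the interval it changes
    nothing.\<close>
  define cl where "cl = (\<lambda>t::real. max (-\<delta>) (min \<delta> t))"
  define J where "J = (\<lambda>u t. integral {-\<delta>..t} (\<lambda>s. W (u s)))"
  define T where "T = (\<lambda>u t. q + J u (cl t) - J u 0)"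
  have L0: "L \<ge> 0" using W lipschitz_on_nonneg by blast
  have Wc: "continuous_on UNIV W" using W lipschitz_on_continuous_on by blast
  have cont: "continuous_on {-\<delta>..\<delta>} (\<lambda>s. W (apply_bcontfun u s))" for u :: "real \<Rightarrow>\<^sub>C 'a"
    by (rule continuous_on_compose2[OF Wc]) auto
  have deriv: "((J (apply_bcontfun u)) has_vector_derivative W (apply_bcontfun u t)) (at t within {-\<delta>..\<delta>})"
    if "t \<in> {-\<delta>..\<delta>}" for u :: "real \<Rightarrow>\<^sub>C 'a" and t
    unfolding J_def using integral_has_vector_derivative[OF cont that] .
  have clc: "continuous_on UNIV cl"
    unfolding cl_def by (intro continuous_intros)
  have clr: "cl t \<in> {-\<delta>..\<delta>}" for t using \<delta>(1) by (auto simp: cl_def)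
  have Jc: "continuous_on {-\<delta>..\<delta>} (J (apply_bcontfun u))" for u :: "real \<Rightarrow>\<^sub>C 'a"
    using deriv has_vector_derivative_continuous continuous_on_eq_continuous_within by blast
  have Tb: "T (apply_bcontfun u) \<in> bcontfun" for u :: "real \<Rightarrow>\<^sub>C 'a"
  proof -
    have 1: "continuous_on UNIV (T (apply_bcontfun u))"
      unfolding T_def
      by (intro continuous_intros continuous_on_compose2[OF Jc clc]) (use clr in auto)
    have "compact (J (apply_bcontfun u) ` {-\<delta>..\<delta>})"
      by (rule compact_continuous_image[OF Jc]) auto
    then obtain B where B: "\<And>s. s \<in> {-\<delta>..\<delta>} \<Longrightarrow> norm (J (apply_bcontfun u) s) \<le> B"
      using compact_imp_bounded bounded_iff by (metis imageI)
    have "norm (T (apply_bcontfun u) t) \<le> norm q + B + B" for t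
      unfolding T_def
      using B[OF clr, of t] B[of 0] \<delta>(1)
        norm_triangle_ineq4[of "q + J (apply_bcontfun u) (cl t)" "J (apply_bcontfun u) 0"]
        norm_triangle_ineq[of q "J (apply_bcontfun u) (cl t)"] by auto
    then show ?thesis using 1 bcontfun_normI by blast
  qed
  define TT where "TT = (\<lambda>u. Bcontfun (T (apply_bcontfun u)))"
  have TTa: "apply_bcontfun (TT u) = T (apply_bcontfun u)" for u
    unfolding TT_def by (rule Bcontfun_inverse[OF Tb])
  have contr: "dist (TT u) (TT v) \<le> (4 * \<delta> * L) * dist u v" for u v
  proof (rule dist_bound)
    fix t
    have JJ: "norm (J (apply_bcontfun u) s - J (apply_bcontfun v) s) \<le> 2 * \<delta> * L * dist u v"
      if s: "s \<in> {-\<delta>..\<delta>}" for s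
    proof -
      have sub: "{-\<delta>..s} \<subseteq> {-\<delta>..\<delta>}" using s by auto
      have i: "(\<lambda>r. W (apply_bcontfun w r)) integrable_on {-\<delta>..s}" for w
        using cont continuous_on_subset[OF _ sub] integrable_continuous_real by blast
      have "J (apply_bcontfun u) s - J (apply_bcontfun v) s
          = integral {-\<delta>..s} (\<lambda>r. W (apply_bcontfun u r) - W (apply_bcontfun v r))"
        unfolding J_def using Henstock_Kurzweil_Integration.integral_diff[OF i i] by simp
      also have "norm \<dots> \<le> (L * dist u v) * (s - - \<delta>)"
      proof (rule integral_bound)
        show "- \<delta> \<le> s" using s by auto
        show "continuous_on {- \<delta>..s} (\<lambda>r. W (apply_bcontfun u r) - W (apply_bcontfun v r))"
          using continuous_on_subset[OF cont sub] by (intro continuous_intros)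
        fix r
        have "norm (W (apply_bcontfun u r) - W (apply_bcontfun v r))
            \<le> L * dist (apply_bcontfun u r) (apply_bcontfun v r)"
          using lipschitz_onD[OF W] by (metis UNIV_I dist_norm)
        also have "\<dots> \<le> L * dist u v"
          using L0 dist_bounded by (intro mult_left_mono) auto
        finally show "norm (W (apply_bcontfun u r) - W (apply_bcontfun v r)) \<le> L * dist u v" .
      qed
      also have "\<dots> \<le> (L * dist u v) * (2 * \<delta>)"
        using s L0 by (intro mult_left_mono) auto
      finally show ?thesis by (simp add: mult_ac)
    qed
    have "dist (T (apply_bcontfun u) t) (T (apply_bcontfun v) t)
      = norm ((J (apply_bcontfun u) (cl t) - J (apply_bcontfun v) (cl t))
          - (J (apply_bcontfun u) 0 - J (apply_bcontfun v) 0))"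
      by (simp add: T_def dist_norm algebra_simps)
    also have "\<dots> \<le> 2 * \<delta> * L * dist u v + 2 * \<delta> * L * dist u v"
      by (rule order_trans[OF norm_triangle_ineq4 add_mono[OF JJ JJ]]) (use clr \<delta>(1) in auto)
    finally show "dist (apply_bcontfun (TT u) t) (apply_bcontfun (TT v) t) \<le> 4 * \<delta> * L * dist u v"
      by (simp add: TTa mult_ac)
  qed
  have "\<exists>!u. TT u = u"
    by (rule banach_fix_type[of "4 * \<delta> * L"]) (use \<delta> L0 contr in auto)
  then obtain u where u: "TT u = u" by blast
  then have fix_u: "apply_bcontfun u t = q + J (apply_bcontfun u) (cl t) - J (apply_bcontfun u) 0" for t
    using TTa[of u] by (simp add: T_def fun_eq_iff)
  show ?thesis
  proof (intro exI[of _ "apply_bcontfun u"] conjI ballI)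
    show "apply_bcontfun u 0 = q"
      using fix_u[of 0] \<delta>(1) by (simp add: cl_def)
    fix t assume t: "t \<in> {-\<delta><..<\<delta>}"
    have "((\<lambda>t. q + J (apply_bcontfun u) t - J (apply_bcontfun u) 0)
        has_vector_derivative W (apply_bcontfun u t)) (at t within {-\<delta>..\<delta>})"
      using deriv[of t u] t by (auto intro!: derivative_eq_intros)
    then have "((\<lambda>t. q + J (apply_bcontfun u) t - J (apply_bcontfun u) 0)
        has_vector_derivative W (apply_bcontfun u t)) (at t)"
      using t by (subst (asm) at_within_interior) auto
    then show "(apply_bcontfun u has_vector_derivative W (apply_bcontfun u t)) (at t)"
      by (rule has_vector_derivative_transform_within_open[of _ _ _ "{-\<delta><..<\<delta>}"])
        (use t in \<open>auto simp: fix_u[symmetric] cl_def fix_u\<close>)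
  qed
qed

lemma norm_diff_le_vector_derivative:
  fixes \<phi> :: "real \<Rightarrow> 'a::real_normed_vector"
  assumes "convex S" "\<And>s. s \<in> S \<Longrightarrow> (\<phi> has_vector_derivative \<phi>' s) (at s)"
    "\<And>s. s \<in> S \<Longrightarrow> norm (\<phi>' s) \<le> B" "a \<in> S" "b \<in> S"
  shows "norm (\<phi> b - \<phi> a) \<le> B * \<bar>b - a\<bar>"
proof -
  have "norm (\<phi> b - \<phi> a) \<le> B * norm (b - a)"
  proof (rule differentiable_bound[OF assms(1) _ _ \<open>b \<in> S\<close> \<open>a \<in> S\<close>])
    show "(\<phi> has_derivative (\<lambda>h. h *\<^sub>R \<phi>' s)) (at s within S)" if "s \<in> S" for s
      using assms(2)[OF that] has_vector_derivative_at_within has_vector_derivative_def by blast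
    show "onorm (\<lambda>h. h *\<^sub>R \<phi>' s) \<le> B" if "s \<in> S" for s
      using assms(3)[OF that] by (simp add: onorm_scaleR_left onorm_id)
  qed
  then show ?thesis by simp
qed

text \<open>The projection onto a closed ball is nonexpansive, so composing \<open>V\<close> with it
  gives a bounded, globally Lipschitz field that agrees with \<open>- V\<close> on the ball.
  Starting points in the half ball cannot leave the ball before time \<open>\<delta>\<close>, so one
  \<open>\<delta>\<close> serves them all.\<close>

lemma picard_local:
  fixes V :: "'a::euclidean_space \<Rightarrow> 'a"
  assumes U: "open U" and V: "locally_lipschitz_on U V" and p: "p \<in> U"
  shows "\<exists>\<rho>>0. \<exists>\<delta>>0. \<forall>q\<in>ball p \<rho>. \<exists>\<phi>. \<phi> 0 = q \<and>
    (\<forall>t\<in>{-\<delta><..<\<delta>}. \<phi> t \<in> U \<and> (\<phi> has_vector_derivative - V (\<phi> t)) (at t))"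
proof -
  obtain r1 L where r1: "r1 > 0" and L1: "L-lipschitz_on (cball p r1 \<inter> U) V"
    using V p unfolding locally_lipschitz_on_def by blast
  obtain r2 where r2: "r2 > 0" "cball p r2 \<subseteq> U"
    using U p open_contains_cball by blast
  define r where "r = min r1 r2"
  have r: "r > 0" "cball p r \<subseteq> U" using r1 r2 by (auto simp: r_def)
  have L: "L-lipschitz_on (cball p r) V"
    by (rule lipschitz_on_subset[OF L1]) (use r in \<open>auto simp: r_def\<close>)
  have L0: "L \<ge> 0" using L lipschitz_on_nonneg by blast
  define P where "P = closest_point (cball p r)"
  define W where "W = (\<lambda>x. - V (P x))"
  have PP: "P x \<in> cball p r" for x
    unfolding P_def using r(1) by (intro closest_point_in_set) auto
  have W: "L-lipschitz_on UNIV W"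
  proof (rule lipschitz_onI[OF _ L0])
    fix x y
    have "dist (W x) (W y) = dist (V (P x)) (V (P y))" by (simp add: W_def dist_norm norm_minus_commute)
    also have "\<dots> \<le> L * dist (P x) (P y)" using lipschitz_onD[OF L PP PP] .
    also have "\<dots> \<le> L * dist x y"
      unfolding P_def using L0 r(1) by (intro mult_left_mono closest_point_lipschitz) auto
    finally show "dist (W x) (W y) \<le> L * dist x y" .
  qed
  define M where "M = norm (V p) + L * r"
  have M0: "M \<ge> 0" using L0 r(1) by (auto simp: M_def)
  have WM: "norm (W x) \<le> M" for x
  proof -
    have "norm (W x) \<le> norm (V p) + dist (V (P x)) (V p)"
      using norm_triangle_ineq4[of "V p" "V p - V (P x)"]
      by (simp add: W_def dist_norm norm_minus_commute)
    also have "dist (V (P x)) (V p) \<le> L * dist (P x) p"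
      using lipschitz_onD[OF L PP] r(1) by auto
    also have "\<dots> \<le> L * r"
      using L0 PP[of x] by (intro mult_left_mono) (auto simp: dist_commute)
    finally show ?thesis by (simp add: M_def)
  qed
  \<comment> \<open>The first bound yields the contraction condition
    \<open>4 * \<delta> * L < 1\<close>, the second limits the distance travelled at speed
    \<open>M\<close> to \<open>r / 2\<close>.\<close>
  define \<delta> where "\<delta> = min (1 / (8 * (L + 1))) (r / (2 * (M + 1)))"
  have \<delta>0: "\<delta> > 0" using L0 M0 r(1) by (auto simp: \<delta>_def)
  have "\<delta> \<le> 1 / (8 * (L + 1))" by (simp add: \<delta>_def)
  then have "\<delta> * (8 * (L + 1)) \<le> 1" using L0 by (simp add: field_simps)
  moreover have "\<delta> * (4 * L) \<le> \<delta> * (8 * L)" using \<delta>0 L0 by (intro mult_left_mono) auto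
  ultimately have \<delta>L: "4 * \<delta> * L < 1" using \<delta>0 by (simp add: algebra_simps)
  have "\<delta> \<le> r / (2 * (M + 1))" by (simp add: \<delta>_def)
  then have "\<delta> * (2 * (M + 1)) \<le> r" using M0 by (simp add: field_simps)
  then have \<delta>M: "M * \<delta> \<le> r / 2" using \<delta>0 by (simp add: algebra_simps)
  have "\<exists>\<phi>. \<phi> 0 = q \<and>
    (\<forall>t\<in>{-\<delta><..<\<delta>}. \<phi> t \<in> U \<and> (\<phi> has_vector_derivative - V (\<phi> t)) (at t))"
    if q: "q \<in> ball p (r / 2)" for q
  proof -
    obtain \<phi> where \<phi>0: "\<phi> 0 = q"
      and \<phi>: "\<And>t. t \<in> {-\<delta><..<\<delta>} \<Longrightarrow> (\<phi> has_vector_derivative W (\<phi> t)) (at t)"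
      using picard_global[OF W \<delta>0 \<delta>L] by blast
    have "\<phi> t \<in> cball p r" if t: "t \<in> {-\<delta><..<\<delta>}" for t
    proof -
      have "norm (\<phi> t - \<phi> 0) \<le> M * \<bar>t - 0\<bar>"
        by (rule norm_diff_le_vector_derivative[of "{-\<delta><..<\<delta>}" _ "\<lambda>t. W (\<phi> t)"])
          (use \<phi> WM t \<delta>0 in auto)
      also have "\<dots> \<le> M * \<delta>" using t M0 by (intro mult_left_mono) auto
      finally have "dist q (\<phi> t) \<le> r / 2"
        using \<delta>M by (simp add: \<phi>0 dist_norm norm_minus_commute)
      then show ?thesis using q dist_triangle[of p "\<phi> t" q] by simp
    qed
    then have "\<phi> t \<in> U \<and> W (\<phi> t) = - V (\<phi> t)" if "t \<in> {-\<delta><..<\<delta>}" for t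
      using that r(2) by (auto simp: W_def P_def closest_point_self)
    then show ?thesis using \<phi>0 \<phi> by metis
  qed
  then show ?thesis using r(1) \<delta>0 by (intro exI[of _ "r/2"] conjI exI[of _ \<delta>]) auto
qed

text \<open>The set of agreement is closed in \<open>I\<close> by continuity and open by a local
  Gronwall estimate for the squared distance \<open>D\<close>, so it is all of the connected set
  \<open>I\<close>. Since \<open>\<bar>D'\<bar> \<le> 2 * L * D\<close>, an exponential weight makes
  \<open>D\<close> monotone on either side of a zero \<open>s\<close>, which forces
  \<open>D = 0\<close> nearby.\<close>

lemma ode_unique:
  fixes V :: "'a::real_inner \<Rightarrow> 'a"
  assumes V: "locally_lipschitz_on U V" and I: "open I" "connected I"
    and x: "\<And>t. t \<in> I \<Longrightarrow> x t \<in> U" "\<And>t. t \<in> I \<Longrightarrow> (x has_vector_derivative - V (x t)) (at t)"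
    and y: "\<And>t. t \<in> I \<Longrightarrow> y t \<in> U" "\<And>t. t \<in> I \<Longrightarrow> (y has_vector_derivative - V (y t)) (at t)"
    and t0: "t0 \<in> I" "x t0 = y t0" and t: "t \<in> I"
  shows "x t = y t"
proof -
  let ?E = "{t \<in> I. x t = y t}"
  have cx: "continuous_on I x" "continuous_on I y"
    by (auto intro!: continuous_at_imp_continuous_on has_vector_derivative_continuous x(2) y(2))
  have "\<exists>e>0. ball s e \<subseteq> ?E" if s: "s \<in> ?E" for s
  proof -
    have sI: "s \<in> I" and xy: "x s = y s" using s by auto
    obtain r L where r: "r > 0" and L: "L-lipschitz_on (cball (x s) r \<inter> U) V"
      using V x(1)[OF sI] unfolding locally_lipschitz_on_def by blast
    have ct: "isCont x s" "isCont y s"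
      using x(2)[OF sI] y(2)[OF sI] has_vector_derivative_continuous by blast+
    obtain d1 where d1: "d1 > 0" "\<And>t. dist t s < d1 \<Longrightarrow> dist (x t) (x s) < r"
      using ct(1) r unfolding continuous_at_eps_delta by blast
    obtain d2 where d2: "d2 > 0" "\<And>t. dist t s < d2 \<Longrightarrow> dist (y t) (y s) < r"
      using ct(2) r unfolding continuous_at_eps_delta by blast
    note d = d1(1) d2(1) d1(2) d2(2)
    obtain d3 where d3: "d3 > 0" "ball s d3 \<subseteq> I" using I(1) sI open_contains_ball by blast
    define e where "e = min d1 (min d2 d3)"
    have e: "e > 0" using d d3 by (auto simp: e_def)
    have inI: "t \<in> I" if "dist t s < e" for t
      using that d3(2) by (auto simp: e_def dist_commute subset_iff)
    have inb: "x t \<in> cball (x s) r \<inter> U" "y t \<in> cball (x s) r \<inter> U" if "dist t s < e" for t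
      using that d(3)[of t] d(4)[of t] x(1)[OF inI[OF that]] y(1)[OF inI[OF that]] xy
      by (auto simp: e_def dist_commute less_imp_le)
    define D where "D = (\<lambda>t. (x t - y t) \<bullet> (x t - y t))"
    define D' where "D' = (\<lambda>t. 2 * ((x t - y t) \<bullet> (V (y t) - V (x t))))"
    have dD: "(D has_real_derivative D' t) (at t)" if "dist t s < e" for t
    proof -
      have "((\<lambda>t. x t - y t) has_vector_derivative (V (y t) - V (x t))) (at t)"
        using x(2)[OF inI[OF that]] y(2)[OF inI[OF that]]
        by (auto intro!: derivative_eq_intros)
      then have "((\<lambda>t. x t - y t) has_derivative (\<lambda>h. h *\<^sub>R (V (y t) - V (x t)))) (at t)"
        by (simp add: has_vector_derivative_def)
      from has_derivative_inner[OF this this] show ?thesis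
        unfolding has_field_derivative_def D_def D'_def
        by (rule has_derivative_eq_rhs) (auto simp: fun_eq_iff inner_commute algebra_simps)
    qed
    have bD: "\<bar>D' t\<bar> \<le> 2 * L * D t" if "dist t s < e" for t
    proof -
      have "norm (V (y t) - V (x t)) \<le> L * norm (x t - y t)"
        using lipschitz_onD[OF L, of "x t" "y t"] inb[OF that]
        by (simp add: dist_norm norm_minus_commute)
      then have "norm (x t - y t) * norm (V (y t) - V (x t)) \<le> norm (x t - y t) * (L * norm (x t - y t))"
        by (intro mult_left_mono) auto
      then show ?thesis
        using Cauchy_Schwarz_ineq2[of "x t - y t" "V (y t) - V (x t)"]
        by (simp add: D_def D'_def abs_mult dot_square_norm power2_eq_square mult_ac)
    qed
    have Ds: "D s = 0" using xy by (simp add: D_def)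
    have D0: "D t \<ge> 0" for t by (simp add: D_def)
    have "x t = y t" if t: "dist t s < e" for t
    proof -
      have "D t \<le> 0"
      proof (cases "s \<le> t")
        case True
        have "exp (- 2 * L * t) * D t \<le> exp (- 2 * L * s) * D s"
        proof (rule DERIV_nonpos_imp_nonincreasing[OF True])
          fix u assume u: "s \<le> u" "u \<le> t"
          then have us: "dist u s < e" using t by (auto simp: dist_real_def)
          have "((\<lambda>u. exp (- 2 * L * u) * D u) has_real_derivative
              exp (- 2 * L * u) * (D' u - 2 * L * D u)) (at u)"
            by (auto intro!: derivative_eq_intros dD[OF us] simp: algebra_simps)
          moreover have "exp (- 2 * L * u) * (D' u - 2 * L * D u) \<le> 0"
            using bD[OF us] by (intro mult_nonneg_nonpos) auto
          ultimately show "\<exists>z. ((\<lambda>u. exp (- 2 * L * u) * D u) has_real_derivative z) (at u) \<and> z \<le> 0"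
            by blast
        qed
        then show ?thesis using Ds by (simp add: mult_le_0_iff)
      next
        case False
        then have ts: "t \<le> s" by simp
        have "exp (2 * L * t) * D t \<le> exp (2 * L * s) * D s"
        proof (rule DERIV_nonneg_imp_nondecreasing[OF ts])
          fix u assume u: "t \<le> u" "u \<le> s"
          then have us: "dist u s < e" using t by (auto simp: dist_real_def)
          have "((\<lambda>u. exp (2 * L * u) * D u) has_real_derivative
              exp (2 * L * u) * (D' u + 2 * L * D u)) (at u)"
            by (auto intro!: derivative_eq_intros dD[OF us] simp: algebra_simps)
          moreover have "0 \<le> exp (2 * L * u) * (D' u + 2 * L * D u)"
            using bD[OF us] by (intro mult_nonneg_nonneg) auto
          ultimately show "\<exists>z. ((\<lambda>u. exp (2 * L * u) * D u) has_real_derivative z) (at u) \<and> 0 \<le> z"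
            by blast
        qed
        then show ?thesis using Ds by (simp add: mult_le_0_iff)
      qed
      then show ?thesis using D0[of t] unfolding D_def
        by (metis antisym inner_eq_zero_iff right_minus_eq)
    qed
    then show ?thesis using e inI
      by (intro exI[of _ e]) (auto simp: dist_commute)
  qed
  then have oE: "open ?E" by (simp add: open_contains_ball)
  have "closedin (top_of_set I) ?E"
    using continuous_closedin_preimage_constant[of I "\<lambda>t. x t - y t" 0] cx
    by (simp add: continuous_on_diff)
  moreover have "openin (top_of_set I) ?E" using oE by (auto intro: open_subset)
  ultimately have "?E = {} \<or> ?E = I" using I(2) connected_clopen by blast
  then show ?thesis using t0 t by blast
qed

section \<open>Maximal solutions\<close>

lemma connected_einterval_Int: "connected (einterval a b \<inter> einterval c d)"
proof -
  have "is_interval (einterval a b \<inter> einterval c d)"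
    unfolding is_interval_1 einterval_iff
    by (meson Int_iff einterval_iff ereal_less_eq(3) le_less_trans less_le_trans)
  then show ?thesis by (rule is_interval_connected)
qed

text \<open>Nothing here asks \<open>F\<close> to be open, so that an affine slice is admissible;
  the price is to require local solutions that stay in \<open>F\<close>. The lifetime
  \<open>\<delta>\<close> is uniform near \<open>p\<close>, which is what continuation past a finite
  end time needs.\<close>

locale ivp =
  fixes V :: "'a::real_inner \<Rightarrow> 'a" and F :: "'a set"
  assumes lipschitz: "locally_lipschitz_on F V"
    and local_existence: "\<And>p. p \<in> F \<Longrightarrow> \<exists>\<rho>>0. \<exists>\<delta>>0. \<forall>q\<in>ball p \<rho> \<inter> F. \<exists>\<phi>. \<phi> 0 = q \<and>
      (\<forall>t\<in>{-\<delta><..<\<delta>}. \<phi> t \<in> F \<and> (\<phi> has_vector_derivative - V (\<phi> t)) (at t))"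
begin

lemma ivp_solution_unique:
  assumes x: "ivp_solution V F x0 a b x" and y: "ivp_solution V F x0 c d y"
    and t: "t \<in> einterval a b" "t \<in> einterval c d"
  shows "x t = y t"
  by (rule ode_unique[OF lipschitz, of "einterval a b \<inter> einterval c d" x y 0])
    (use x y t connected_einterval_Int in \<open>auto simp: ivp_solution_def einterval_iff zero_ereal_def\<close>)

text \<open>Two solutions agree wherever both are defined, so all of them glue to a single one
  between the least left and the greatest right endpoint. Every solution is a restriction of the
  glued one, which gives maximality and uniqueness at once.\<close>

lemma maximal_solution_exists_unique:
  assumes x0: "x0 \<in> F"
  obtains Tm TM x where "maximal_solution V F x0 Tm TM x"
    "\<And>Sm SM y. maximal_solution V F x0 Sm SM y \<Longrightarrow>
      Sm = Tm \<and> SM = TM \<and> (\<forall>t\<in>einterval Tm TM. y t = x t)"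
proof -
  define S where "S = {(a, b, y). ivp_solution V F x0 a b y}"
  define Tm where "Tm = Inf (fst ` S)"
  define TM where "TM = Sup ((fst \<circ> snd) ` S)"
  define sol where "sol = (\<lambda>t. SOME y. \<exists>a b. ivp_solution V F x0 a b y \<and> t \<in> einterval a b)"
  define x where "x = (\<lambda>t. sol t t)"
  obtain \<delta> \<phi> where "\<delta> > 0" "\<phi> 0 = x0"
    "\<And>t. t \<in> {-\<delta><..<\<delta>} \<Longrightarrow> \<phi> t \<in> F \<and> (\<phi> has_vector_derivative - V (\<phi> t)) (at t)"
    using local_existence[OF x0] x0 by (metis IntI centre_in_ball)
  then have ne: "ivp_solution V F x0 (ereal (-\<delta>)) (ereal \<delta>) \<phi>"
    unfolding ivp_solution_def einterval_eq by (auto simp: zero_ereal_def)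
  have bd: "Tm \<le> a" "b \<le> TM" if "ivp_solution V F x0 a b y" for a b y
    using that unfolding Tm_def TM_def S_def by (force intro: Inf_lower Sup_upper)+
  have xy: "x t = y t" if y: "ivp_solution V F x0 a b y" "t \<in> einterval a b" for a b y t
  proof -
    have "\<exists>a b. ivp_solution V F x0 a b (sol t) \<and> t \<in> einterval a b"
      unfolding sol_def
      by (rule someI_ex[of "\<lambda>y. \<exists>a b. ivp_solution V F x0 a b y \<and> t \<in> einterval a b"])
        (use y in blast)
    then show ?thesis unfolding x_def using ivp_solution_unique y by blast
  qed
  \<comment> \<open>The two endpoints are optimized independently, yet a single solution reaches t:
    every solution interval contains 0, so only the endpoint on the side of t matters.\<close>
  have cover: "\<exists>a b y. ivp_solution V F x0 a b y \<and> t \<in> einterval a b" if t: "t \<in> einterval Tm TM" for t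
  proof (cases "t \<le> 0")
    case True
    obtain a b y where "ivp_solution V F x0 a b y" "a < ereal t"
      using t unfolding einterval_iff Tm_def S_def Inf_less_iff by auto
    moreover from this have "ereal t < b"
      using True le_less_trans[of "ereal t" 0 b] by (simp add: ivp_solution_def)
    ultimately show ?thesis by (auto simp: einterval_iff)
  next
    case False
    obtain a b y where "ivp_solution V F x0 a b y" "ereal t < b"
      using t unfolding einterval_iff TM_def S_def less_Sup_iff by auto
    moreover from this have "a < ereal t"
      using False less_trans[of a 0 "ereal t"] by (simp add: ivp_solution_def)
    ultimately show ?thesis by (auto simp: einterval_iff)
  qed
  have sol: "ivp_solution V F x0 Tm TM x"
    unfolding ivp_solution_def
  proof (intro conjI ballI)
    show "Tm < 0" "0 < TM"
      using bd[OF ne] ne le_less_trans[of Tm _ 0] less_le_trans[of 0 _ TM]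
      unfolding ivp_solution_def by blast+
    show "x 0 = x0" using xy[OF ne] ne by (simp add: ivp_solution_def einterval_iff)
    fix t assume "t \<in> einterval Tm TM"
    then obtain a b y where y: "ivp_solution V F x0 a b y" "t \<in> einterval a b" using cover by blast
    then show "x t \<in> F" using xy by (metis ivp_solution_def)
    show "(x has_vector_derivative - V (x t)) (at t)"
    proof (rule has_vector_derivative_transform_within_open[of y _ _ "einterval a b"])
      show "(y has_vector_derivative - V (x t)) (at t)"
        using y xy[OF y] by (simp add: ivp_solution_def)
      show "y u = x u" if "u \<in> einterval a b" for u using xy[OF y(1) that] by simp
    qed (use y in auto)
  qed
  have max: "maximal_solution V F x0 Tm TM x"
    unfolding maximal_solution_def using sol bd by (meson order_antisym)
  moreover have "Sm = Tm \<and> SM = TM \<and> (\<forall>t\<in>einterval Tm TM. y t = x t)"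
    if "maximal_solution V F x0 Sm SM y" for Sm SM y
  proof -
    have y: "ivp_solution V F x0 Sm SM y" using that by (simp add: maximal_solution_def)
    then have "Tm = Sm \<and> TM = SM"
      using that sol bd[OF y] xy[OF y] unfolding maximal_solution_def by blast
    then show ?thesis using xy[OF y] by auto
  qed
  ultimately show ?thesis using that by blast
qed

text \<open>Near \<open>p\<close> all local solutions live for the same time
  \<open>\<delta>\<close>. Restarting from \<open>x r\<close> with \<open>T - r < \<delta>\<close>
  therefore reaches past \<open>T\<close>. A cluster point suffices; convergence of \<open>x\<close>
  at \<open>T\<close> is not presupposed.\<close>

lemma maximal_solution_no_cluster_point:
  assumes max: "maximal_solution V F x0 Tm (ereal T) x"
    and s: "\<And>j. 0 \<le> s j" "\<And>j. s j < T" "s \<longlonglongrightarrow> T" and p: "(\<lambda>j. x (s j)) \<longlonglongrightarrow> p" "p \<in> F"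
  shows False
proof -
  have sol: "ivp_solution V F x0 Tm (ereal T) x" using max by (simp add: maximal_solution_def)
  have xin: "x t \<in> F" "(x has_vector_derivative - V (x t)) (at t)"
    if "t \<in> einterval Tm (ereal T)" for t
    using sol that by (auto simp: ivp_solution_def)
  obtain \<rho> \<delta> where \<rho>: "\<rho> > 0" and \<delta>: "\<delta> > 0" and ex: "\<And>q. q \<in> ball p \<rho> \<inter> F \<Longrightarrow> \<exists>\<phi>. \<phi> 0 = q \<and>
      (\<forall>t\<in>{-\<delta><..<\<delta>}. \<phi> t \<in> F \<and> (\<phi> has_vector_derivative - V (\<phi> t)) (at t))"
    using local_existence[OF p(2)] by blast
  have "\<forall>\<^sub>F j in sequentially. dist (x (s j)) p < \<rho>" using tendstoD[OF p(1) \<rho>] .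
  moreover have "\<forall>\<^sub>F j in sequentially. dist (s j) T < \<delta>" using tendstoD[OF s(3) \<delta>] .
  ultimately have "\<forall>\<^sub>F j in sequentially. dist (x (s j)) p < \<rho> \<and> dist (s j) T < \<delta>"
    by (rule eventually_conj)
  then obtain j where j: "dist (x (s j)) p < \<rho>" "dist (s j) T < \<delta>"
    by (auto dest: eventually_happens)
  define r where "r = s j"
  have r: "0 \<le> r" "r < T" "T < r + \<delta>" using s(1,2)[of j] j(2) by (auto simp: r_def dist_real_def)
  have Tm: "Tm < 0" using sol by (simp add: ivp_solution_def)
  have rI: "r \<in> einterval Tm (ereal T)"
    using r Tm by (auto simp: einterval_iff intro: less_le_trans)
  obtain \<phi> where \<phi>0: "\<phi> 0 = x r"
    and \<phi>: "\<And>t. t \<in> {-\<delta><..<\<delta>} \<Longrightarrow> \<phi> t \<in> F \<and> (\<phi> has_vector_derivative - V (\<phi> t)) (at t)"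
    using ex[of "x r"] j(1) xin(1)[OF rI] by (auto simp: r_def dist_commute)
  define y where "y = (\<lambda>t. \<phi> (t - r))"
  have y: "y t \<in> F" "(y has_vector_derivative - V (y t)) (at t)" if "t \<in> {r-\<delta><..<r+\<delta>}" for t
  proof -
    have t: "t - r \<in> {-\<delta><..<\<delta>}" using that by auto
    then show "y t \<in> F" using \<phi> by (simp add: y_def)
    have "((\<lambda>t. t - r) has_vector_derivative 1) (at t)"
      by (auto intro!: derivative_eq_intros)
    from vector_diff_chain_at[OF this, of \<phi>] \<phi>[OF t]
    show "(y has_vector_derivative - V (y t)) (at t)"
      by (auto simp: y_def o_def)
  qed
  have eq: "x t = y t" if "t \<in> einterval Tm (ereal T)" "t \<in> {r-\<delta><..<r+\<delta>}" for t
    by (rule ode_unique[OF lipschitz _ connected_einterval_Int, of Tm "ereal T" "ereal (r-\<delta>)" "ereal (r+\<delta>)" x y r])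
      (use xin y rI that \<delta> \<phi>0 in \<open>auto simp: y_def\<close>)
  \<comment> \<open>By uniqueness \<open>z\<close> equals \<open>y\<close> on the whole interval
    after \<open>r\<close>, hence it is differentiable across the switch at \<open>T\<close> as
    well.\<close>
  define z where "z = (\<lambda>t. if t < T then x t else y t)"
  have "ivp_solution V F x0 Tm (ereal (r + \<delta>)) z"
    unfolding ivp_solution_def
  proof (intro conjI ballI)
    show "Tm < 0" "0 < ereal (r + \<delta>)" using Tm r \<delta> by auto
    show "z 0 = x0" using sol r by (auto simp: z_def ivp_solution_def)
    fix t assume t: "t \<in> einterval Tm (ereal (r + \<delta>))"
    have "z t \<in> F \<and> (z has_vector_derivative - V (z t)) (at t)"
    proof (cases "t < T")
      case True
      then have tI: "t \<in> einterval Tm (ereal T)" using t by (simp add: einterval_iff)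
      have "(z has_vector_derivative - V (x t)) (at t)"
        by (rule has_vector_derivative_transform_within_open[OF xin(2)[OF tI], of "{..<T}"])
          (use True in \<open>auto simp: z_def\<close>)
      then show ?thesis using True xin(1)[OF tI] by (simp add: z_def)
    next
      case False
      then have tI: "t \<in> {r<..<r+\<delta>}" using t r by (simp add: einterval_iff)
      have "(z has_vector_derivative - V (y t)) (at t)"
      proof (rule has_vector_derivative_transform_within_open[of y _ _ "{r<..<r+\<delta>}"])
        show "y u = z u" if "u \<in> {r<..<r+\<delta>}" for u
        proof (cases "u < T")
          case True
          have "u \<in> einterval Tm (ereal T)"
            using rI that True by (auto simp: einterval_iff intro: less_trans)
          then show ?thesis using eq[of u] that \<delta> True by (auto simp: z_def)
        qed (simp add: z_def)
      qed (use y tI \<delta> in auto)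
      then show ?thesis using False y(1)[of t] tI \<delta> by (simp add: z_def)
    qed
    then show "z t \<in> F" "(z has_vector_derivative - V (z t)) (at t)" by auto
  qed
  moreover have "\<forall>t\<in>einterval Tm (ereal T). z t = x t" by (auto simp: z_def einterval_iff)
  moreover have "ereal T \<le> ereal (r + \<delta>)" using r by simp
  ultimately have "ereal (r + \<delta>) = ereal T"
    using max unfolding maximal_solution_def by (metis order_refl)
  then show False using r by simp
qed

end

section \<open>Gradients and Hessians\<close>

text \<open>Riesz representation in an orthonormal basis; uniqueness of the representing vector
  gives the definite description in \<open>grad\<close> its meaning.\<close>

lemma has_derivative_grad:
  fixes g :: "'a::euclidean_space \<Rightarrow> real"
  assumes "g differentiable (at x)"
  shows "(g has_derivative (\<lambda>v. v \<bullet> grad g x)) (at x)"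
proof -
  obtain g' where g': "(g has_derivative g') (at x)"
    using assms unfolding differentiable_def by blast
  define D where "D = (\<Sum>i\<in>Basis. g' i *\<^sub>R i)"
  have lin: "linear g'" using g' has_derivative_linear by blast
  have "g' = (\<lambda>v. v \<bullet> D)"
  proof
    fix v
    have "g' v = g' (\<Sum>i\<in>Basis. (v \<bullet> i) *\<^sub>R i)" by (simp add: euclidean_representation)
    also have "\<dots> = (\<Sum>i\<in>Basis. (v \<bullet> i) * g' i)" by (simp add: linear_sum[OF lin] linear_cmul[OF lin])
    also have "\<dots> = v \<bullet> D" by (simp add: D_def inner_sum_right mult.commute)
    finally show "g' v = v \<bullet> D" .
  qed
  then have D: "GDERIV g x :> D" using g' by (simp add: gderiv_def)
  have "grad g x = D"
    unfolding grad_def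
  proof (rule the_equality)
    show "GDERIV g x :> D" by (rule D)
    fix E assume "GDERIV g x :> E"
    then have "(\<lambda>v. v \<bullet> E) = (\<lambda>v. v \<bullet> D)"
      using D has_derivative_unique unfolding gderiv_def by blast
    then show "E = D" by (metis inner_commute vector_eq_rdot)
  qed
  then show ?thesis using D by (simp add: gderiv_def)
qed

lemma has_real_derivative_along:
  fixes g :: "'a::euclidean_space \<Rightarrow> real"
  assumes "g differentiable (at (x t))" "(x has_vector_derivative v) (at t)"
  shows "((\<lambda>t. g (x t)) has_real_derivative grad g (x t) \<bullet> v) (at t)"
proof -
  have "((\<lambda>t. g (x t)) has_derivative (\<lambda>s. (s *\<^sub>R v) \<bullet> grad g (x t))) (at t)"
    by (rule has_derivative_compose[of x _ t UNIV g])
      (use assms has_derivative_grad in \<open>auto simp: has_vector_derivative_def\<close>)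
  then show ?thesis
    unfolding has_field_derivative_def
    by (rule has_derivative_eq_rhs) (simp add: fun_eq_iff inner_commute)
qed

lemma grad_has_vector_derivative_along:
  assumes "grad g differentiable (at (x t))" "(x has_vector_derivative v) (at t)"
  shows "((\<lambda>t. grad g (x t)) has_vector_derivative hessian g (x t) *v v) (at t)"
proof -
  have "(grad g has_derivative (\<lambda>v. hessian g (x t) *v v)) (at (x t))"
    using assms(1) by (simp add: jacobian_works hessian_def)
  from has_derivative_compose[of x "\<lambda>s. s *\<^sub>R v" t UNIV "grad g", OF _ this] assms(2)
  show ?thesis
    by (simp add: has_vector_derivative_def matrix_vector_mult_scaleR)
qed

text \<open>A positive slope at x towards a would make f exceed \<open>f x\<close> on the segment
  from x to a, which lies in the convex sublevel set at level \<open>f x\<close>.\<close>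

lemma quasi_convex_grad_nonpos:
  fixes f :: "'a::euclidean_space \<Rightarrow> real"
  assumes qc: "quasi_convex f" and f: "f differentiable (at x)" and le: "f a \<le> f x"
  shows "grad f x \<bullet> (a - x) \<le> 0"
proof (rule ccontr)
  assume neg: "\<not> ?thesis"
  have "((\<lambda>s. x + s *\<^sub>R (a - x)) has_vector_derivative (a - x)) (at 0)"
    by (auto intro!: derivative_eq_intros)
  from has_real_derivative_along[OF _ this, of f] f
  have "((\<lambda>s. f (x + s *\<^sub>R (a - x))) has_real_derivative grad f x \<bullet> (a - x)) (at 0)" by simp
  from DERIV_pos_inc_right[OF this] neg obtain d where d: "d > 0"
    "\<And>s. 0 < s \<Longrightarrow> s < d \<Longrightarrow> f x < f (x + s *\<^sub>R (a - x))" by auto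
  define s where "s = min (d / 2) 1"
  have s: "0 < s" "s < d" "s \<le> 1" using d by (auto simp: s_def)
  have "convex {y. f y \<le> f x}" using qc by (simp add: quasi_convex_def)
  from convexD[OF this, of x a "1 - s" s] le s
  have "f ((1 - s) *\<^sub>R x + s *\<^sub>R a) \<le> f x" by simp
  moreover have "(1 - s) *\<^sub>R x + s *\<^sub>R a = x + s *\<^sub>R (a - x)" by (simp add: algebra_simps)
  ultimately show False using d(2)[OF s(1,2)] by simp
qed

text \<open>Along the segment from z to y, which convexity keeps in \<open>C\<close>, the derivative
  of the gradient paired with \<open>y - z\<close> is the Hessian form at
  \<open>y - z\<close>.\<close>

lemma grad_monotone:
  assumes C: "convex C" and g: "\<And>x. x \<in> C \<Longrightarrow> grad g differentiable (at x)"
    and pos: "\<And>x v. x \<in> C \<Longrightarrow> 0 \<le> (hessian g x *v v) \<bullet> v"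
    and y: "y \<in> C" and z: "z \<in> C"
  shows "0 \<le> (grad g y - grad g z) \<bullet> (y - z)"
proof -
  define p where "p = (\<lambda>s. z + s *\<^sub>R (y - z))"
  have pC: "p s \<in> C" if "0 \<le> s" "s \<le> 1" for s
    using convexD[OF C z y, of "1 - s" s] that by (simp add: p_def algebra_simps)
  have "grad g (p 0) \<bullet> (y - z) \<le> grad g (p 1) \<bullet> (y - z)"
  proof (rule DERIV_nonneg_imp_nondecreasing[of 0 1 "\<lambda>s. grad g (p s) \<bullet> (y - z)"])
    fix s :: real assume s: "0 \<le> s" "s \<le> 1"
    have "(p has_vector_derivative (y - z)) (at s)"
      unfolding p_def by (auto intro!: derivative_eq_intros)
    from grad_has_vector_derivative_along[OF g[OF pC[OF s]] this]
    have "((\<lambda>s. grad g (p s) \<bullet> (y - z)) has_vector_derivative (hessian g (p s) *v (y - z)) \<bullet> (y - z)) (at s)"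
      by (rule bounded_linear.has_vector_derivative[OF bounded_linear_inner_left])
    then show "\<exists>D. ((\<lambda>s. grad g (p s) \<bullet> (y - z)) has_real_derivative D) (at s) \<and> 0 \<le> D"
      using pos[OF pC[OF s]] has_real_derivative_iff_has_vector_derivative by blast
  qed simp
  then show ?thesis by (simp add: p_def inner_diff_left)
qed

section \<open>Positive definite matrices\<close>

text \<open>On the matrix type \<open>norm\<close> is the Frobenius norm, which is also the one
  measuring the Lipschitz continuity of the Hessian; Cauchy-Schwarz is applied row by row.\<close>

lemma norm_matrix_vector_mult_le:
  fixes M :: "real^'n^'m"
  shows "norm (M *v v) \<le> norm M * norm v"
proof -
  have "norm (M *v v) \<le> L2_set (\<lambda>i. norm (M $ i) * norm v) UNIV"
    unfolding norm_vec_def[of "M *v v"]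
    by (rule L2_set_mono) (auto simp: matrix_vector_mul_component Cauchy_Schwarz_ineq2)
  also have "\<dots> = norm M * norm v"
    by (simp add: norm_vec_def[of M] L2_set_left_distrib)
  finally show ?thesis .
qed

text \<open>The constant is the minimum of the quadratic form on the compact unit sphere;
  homogeneity does the rest.\<close>

lemma sym_pos_def_coercive:
  assumes "sym_pos_def M"
  obtains c where "c > 0" "\<And>v. c * (norm v)\<^sup>2 \<le> (M *v v) \<bullet> v"
proof -
  let ?S = "sphere (0::real^'a) 1" and ?q = "\<lambda>v. (M *v v) \<bullet> v"
  have "axis undefined 1 \<in> ?S" by (simp add: norm_axis_1)
  then have "?S \<noteq> {}" by blast
  moreover have "continuous_on ?S ?q"
    by (intro continuous_intros linear_continuous_on matrix_vector_mul_bounded_linear)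
  ultimately obtain u where u: "u \<in> ?S" "\<And>v. v \<in> ?S \<Longrightarrow> ?q u \<le> ?q v"
    using continuous_attains_inf[of ?S ?q] compact_sphere by blast
  have "?q u > 0" using assms u(1) unfolding sym_pos_def_def by (metis mem_sphere_0 norm_zero zero_neq_one)
  moreover have "?q u * (norm v)\<^sup>2 \<le> ?q v" for v
  proof (cases "v = 0")
    case False
    have "?q u \<le> ?q ((1 / norm v) *\<^sub>R v)" by (rule u(2)) (use False in simp)
    also have "\<dots> = ?q v / (norm v)\<^sup>2"
      by (simp add: matrix_vector_mult_scaleR power2_eq_square)
    finally show ?thesis using False by (simp add: field_simps)
  qed simp
  ultimately show ?thesis using that by blast
qed

text \<open>Expand \<open>0 \<le> M z \<bullet> z\<close> at \<open>z = v - \<lambda>\<^sup>-\<^sup>1 M\<^sup>-\<^sup>1 v\<close>.\<close>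

lemma sym_pos_def_norm_le:
  assumes M: "sym_pos_def M" and l: "onorm ((*v) (matrix_inv M)) \<le> l" "l > 0"
  shows "(norm v)\<^sup>2 \<le> l * ((M *v v) \<bullet> v)"
proof -
  define w where "w = matrix_inv M *v v"
  have Mw: "M *v w = v"
    using matrix_inv_mult(1)[OF sym_pos_def_invertible[OF M]]
    by (simp add: w_def matrix_vector_mul_assoc)
  have sym: "(M *v a) \<bullet> c = a \<bullet> (M *v c)" for a c
    using M unfolding sym_pos_def_def by (metis dot_lmul_matrix inner_commute transpose_matrix_vector)
  have "norm w \<le> onorm ((*v) (matrix_inv M)) * norm v"
    unfolding w_def by (rule onorm[OF matrix_vector_mul_bounded_linear])
  also have "\<dots> \<le> l * norm v" using l by (intro mult_right_mono) auto
  finally have "norm v * norm w \<le> norm v * (l * norm v)" by (intro mult_left_mono) auto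
  then have vw: "v \<bullet> w \<le> l * (norm v)\<^sup>2"
    using norm_cauchy_schwarz[of v w] by (simp add: power2_eq_square mult_ac)
  define z where "z = v - (1 / l) *\<^sub>R w"
  have "0 \<le> (M *v z) \<bullet> z"
    using M unfolding sym_pos_def_def by (cases "z = 0") (auto simp: less_imp_le)
  also have "(M *v z) \<bullet> z = (M *v v) \<bullet> v - 2 / l * (norm v)\<^sup>2 + 1 / l * (1 / l * (v \<bullet> w))"
    using sym[of v w] by (simp add: z_def matrix_vector_mult_diff_distrib matrix_vector_mult_scaleR Mw
        inner_diff_left inner_diff_right inner_commute power2_norm_eq_inner algebra_simps)
  also have "1 / l * (1 / l * (v \<bullet> w)) \<le> 1 / l * (1 / l * (l * (norm v)\<^sup>2))"
    using vw l by (intro mult_left_mono) auto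
  finally have "0 \<le> (M *v v) \<bullet> v - (norm v)\<^sup>2 / l" using l by simp
  then show ?thesis using l by (simp add: field_simps)
qed

text \<open>With \<open>d\<close> the difference of the two vectors, the defining property of the second one gives
  \<open>M\<^sub>1 d \<bullet> d = (g\<^sub>1 - g\<^sub>2) \<bullet> d + (M\<^sub>2 - M\<^sub>1) w\<^sub>2 \<bullet> d\<close>.\<close>

lemma slice_grad_diff_le:
  fixes A :: "real^'n^'m"
  assumes A: "rank A = CARD('m)" and M: "sym_pos_def M1" "sym_pos_def M2"
    and k: "\<And>v. k * (norm v)\<^sup>2 \<le> (M1 *v v) \<bullet> v"
  shows "k * norm (slice_grad A M1 g1 - slice_grad A M2 g2)
    \<le> norm (g1 - g2) + norm (M1 - M2) * norm (slice_grad A M2 g2)"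
proof -
  let ?w1 = "slice_grad A M1 g1" and ?w2 = "slice_grad A M2 g2"
  define d where "d = ?w1 - ?w2"
  have 1: "A *v ?w1 = 0" "\<And>u. A *v u = 0 \<Longrightarrow> (M1 *v ?w1) \<bullet> u = g1 \<bullet> u"
    using slice_grad_iff[OF A M(1), of ?w1 g1] by auto
  have 2: "A *v ?w2 = 0" "\<And>u. A *v u = 0 \<Longrightarrow> (M2 *v ?w2) \<bullet> u = g2 \<bullet> u"
    using slice_grad_iff[OF A M(2), of ?w2 g2] by auto
  have d: "A *v d = 0" using 1(1) 2(1) by (simp add: d_def matrix_vector_mult_diff_distrib)
  have "k * (norm d)\<^sup>2 \<le> (M1 *v d) \<bullet> d" by (rule k)
  also have "\<dots> = (g1 - g2) \<bullet> d - ((M1 - M2) *v ?w2) \<bullet> d"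
    using 1(2)[OF d] 2(2)[OF d] by (simp add: d_def matrix_vector_mult_diff_distrib
        matrix_vector_mult_diff_rdistrib inner_diff_left)
  also have "\<dots> \<le> norm (g1 - g2) * norm d + norm ((M1 - M2) *v ?w2) * norm d"
    using norm_cauchy_schwarz[of "g1 - g2" d] Cauchy_Schwarz_ineq2[of "(M1 - M2) *v ?w2" d] by linarith
  also have "\<dots> \<le> norm (g1 - g2) * norm d + (norm (M1 - M2) * norm ?w2) * norm d"
    by (intro add_left_mono mult_right_mono norm_matrix_vector_mult_le) simp
  finally have "k * norm d * norm d \<le> (norm (g1 - g2) + norm (M1 - M2) * norm ?w2) * norm d"
    by (simp add: power2_eq_square algebra_simps)
  then show ?thesis
    by (cases "d = 0") (auto simp: d_def)
qed

lemma slice_grad_norm_le: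
  fixes A :: "real^'n^'m"
  assumes A: "rank A = CARD('m)" and M: "sym_pos_def M"
    and k: "\<And>v. k * (norm v)\<^sup>2 \<le> (M *v v) \<bullet> v"
  shows "k * norm (slice_grad A M g) \<le> norm g"
proof -
  have "slice_grad A M 0 = 0"
    using slice_grad_iff[OF A M, of 0 0] by simp
  then show ?thesis using slice_grad_diff_le[OF A M M k, of g 0] by simp
qed

section \<open>The Hessian Riemannian gradient flow\<close>

locale hessian_flow =
  fixes A :: "real^'n^'m" and b :: "real^'m" and C F :: "(real^'n) set"
    and f :: "real^'n \<Rightarrow> real" and h :: "real^'n \<Rightarrow> ereal"
  assumes full_rank: "rank A = CARD('m)"
    and C: "open C" "convex C"
    and F: "F = C \<inter> affine_slice A b"
    and f: "C1_on UNIV f" "locally_lipschitz_on UNIV (grad f)"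
    and h_C2: "C2_on C (rpart h)"
    and h_pos: "\<And>x. x \<in> C \<Longrightarrow> sym_pos_def (hessian (rpart h) x)"
    and h_lip: "locally_lipschitz_on C (hessian (rpart h))"
    and h_smooth: "essentially_smooth h"
    and h_dom: "interior (eff_dom h) = C"
begin

abbreviation "H \<equiv> hessian (rpart h)"
abbreviation "V \<equiv> riem_grad A h f"

lemma f_differentiable: "f differentiable (at x)"
  using f(1) by (simp add: C1_on_def)

lemma h_differentiable:
  assumes "x \<in> C"
  shows "rpart h differentiable (at x)" "grad (rpart h) differentiable (at x)"
  using h_C2 assms by (auto simp: C2_on_def C1_on_def)

lemma H_nonneg: "x \<in> C \<Longrightarrow> 0 \<le> (H x *v v) \<bullet> v"
  using h_pos unfolding sym_pos_def_def by (cases "v = 0") (auto simp: less_imp_le)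

text \<open>These two identities are how \<open>V\<close> enters the derivative computations along
  the flow; the matrix formula is not expanded there.\<close>

lemma V_tangent: "x \<in> C \<Longrightarrow> A *v V x = 0"
  and V_gradient: "x \<in> C \<Longrightarrow> A *v u = 0 \<Longrightarrow> (H x *v V x) \<bullet> u = grad f x \<bullet> u"
  using slice_grad_iff[OF full_rank h_pos, of x "V x" "grad f x"] by (auto simp: riem_grad_def)

text \<open>Coercivity of \<open>H x\<close> with constant \<open>c\<close> persists with
  \<open>c / 2\<close> on a small ball. This bounds \<open>V\<close> there, and then
  \<open>slice_grad_diff_le\<close> transfers the Lipschitz bounds of \<open>H\<close> and
  \<open>grad f\<close> to \<open>V\<close>.\<close>

lemma V_locally_lipschitz: "locally_lipschitz_on C V"
  unfolding locally_lipschitz_on_def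
proof
  fix x assume x: "x \<in> C"
  obtain r0 where r0: "r0 > 0" "cball x r0 \<subseteq> C" using C(1) x open_contains_cball by blast
  obtain r1 L1 where r1: "r1 > 0" "L1-lipschitz_on (cball x r1 \<inter> C) H"
    using h_lip x unfolding locally_lipschitz_on_def by blast
  obtain r2 L2 where r2: "r2 > 0" "L2-lipschitz_on (cball x r2 \<inter> UNIV) (grad f)"
    using f(2) unfolding locally_lipschitz_on_def by blast
  have L0: "L1 \<ge> 0" "L2 \<ge> 0" using r1 r2 lipschitz_on_nonneg by blast+
  obtain c where c: "c > 0" "\<And>v. c * (norm v)\<^sup>2 \<le> (H x *v v) \<bullet> v"
    using sym_pos_def_coercive[OF h_pos[OF x]] by blast
  \<comment> \<open>The last term ensures \<open>L1 * r \<le> c / 2\<close>, so the perturbation of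
    \<open>H\<close> costs at most half of the coercivity; the 1 guards against
    \<open>L1 = 0\<close>.\<close>
  define r where "r = min (min r0 r1) (min r2 (c / (2 * (L1 + 1))))"
  define k where "k = c / 2"
  define G where "G = norm (grad f x) + L2 * r"
  have r: "r > 0" "r \<le> r0" "r \<le> r1" "r \<le> r2" using r0 r1 r2 c L0 by (auto simp: r_def)
  have "r \<le> c / (2 * (L1 + 1))" by (simp add: r_def)
  then have "L1 * r \<le> k" using L0 r(1) by (simp add: k_def field_simps)
  have k: "k > 0" using c by (simp add: k_def)
  have sub: "cball x r \<subseteq> C" "cball x r \<subseteq> cball x r1 \<inter> C" "cball x r \<subseteq> cball x r2 \<inter> UNIV"
    using r r0 by auto
  have HL: "norm (H y - H z) \<le> L1 * dist y z" if "y \<in> cball x r" "z \<in> cball x r" for y z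
    using lipschitz_onD[OF r1(2)] that sub(2) by (metis dist_norm subsetD)
  have gL: "norm (grad f y - grad f z) \<le> L2 * dist y z" if "y \<in> cball x r" "z \<in> cball x r" for y z
    using lipschitz_onD[OF r2(2)] that sub(3) by (metis dist_norm subsetD)
  have coer: "k * (norm v)\<^sup>2 \<le> (H y *v v) \<bullet> v" if y: "y \<in> cball x r" for y v
  proof -
    have "norm (H x - H y) \<le> L1 * dist x y" using HL y r(1) by simp
    also have "\<dots> \<le> L1 * r" using y L0 by (intro mult_left_mono) auto
    finally have "norm (H x - H y) \<le> k" using \<open>L1 * r \<le> k\<close> by simp
    have "((H x - H y) *v v) \<bullet> v \<le> norm ((H x - H y) *v v) * norm v" by (rule norm_cauchy_schwarz)
    also have "\<dots> \<le> (norm (H x - H y) * norm v) * norm v"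
      by (intro mult_right_mono norm_matrix_vector_mult_le) simp
    also have "\<dots> \<le> (k * norm v) * norm v"
      using \<open>norm (H x - H y) \<le> k\<close> by (intro mult_right_mono) auto
    finally have "(H x *v v) \<bullet> v - (H y *v v) \<bullet> v \<le> k * (norm v)\<^sup>2"
      by (simp add: matrix_vector_mult_diff_rdistrib inner_diff_left power2_eq_square mult_ac)
    then show ?thesis using c(2)[of v] by (simp add: k_def)
  qed
  have Vb: "norm (V y) \<le> G / k" if y: "y \<in> cball x r" for y
  proof -
    have "k * norm (V y) \<le> norm (grad f y)"
      unfolding riem_grad_def using slice_grad_norm_le[OF full_rank h_pos coer[OF y]] y sub(1) by blast
    also have "\<dots> \<le> norm (grad f x) + norm (grad f y - grad f x)"
      by (metis add.commute diff_add_cancel norm_triangle_ineq)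
    also have "norm (grad f y - grad f x) \<le> L2 * dist y x" using gL y r(1) by simp
    also have "\<dots> \<le> L2 * r" using y L0 by (intro mult_left_mono) (auto simp: dist_commute)
    finally show ?thesis using k by (simp add: G_def field_simps)
  qed
  have G0: "G \<ge> 0" using L0 r(1) by (simp add: G_def)
  have "((L2 + L1 * (G / k)) / k)-lipschitz_on (cball x r) V"
  proof (rule lipschitz_onI)
    fix y z assume yz: "y \<in> cball x r" "z \<in> cball x r"
    have "k * norm (V y - V z) \<le> norm (grad f y - grad f z) + norm (H y - H z) * norm (V z)"
      unfolding riem_grad_def
      using slice_grad_diff_le[OF full_rank h_pos h_pos coer[OF yz(1)]] yz sub(1) by blast
    also have "\<dots> \<le> L2 * dist y z + (L1 * dist y z) * (G / k)"
      using gL[OF yz] HL[OF yz] Vb[OF yz(2)] L0 by (intro add_mono mult_mono) auto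
    finally show "dist (V y) (V z) \<le> (L2 + L1 * (G / k)) / k * dist y z"
      using k by (simp add: dist_norm field_simps)
  qed (use L0 G0 k in auto)
  then have "((L2 + L1 * (G / k)) / k)-lipschitz_on (cball x r \<inter> C) V"
    by (rule lipschitz_on_subset) auto
  then show "\<exists>r>0. \<exists>L. L-lipschitz_on (cball x r \<inter> C) V" using r(1) by blast
qed

text \<open>Picard's theorem gives solutions in the open set \<open>C\<close>; along them
  \<open>A *v \<phi> t\<close> has derivative 0 because \<open>V\<close> is tangent, so a solution
  starting in the slice stays in it.\<close>

sublocale ivp V F
proof
  show "locally_lipschitz_on F V"
    unfolding locally_lipschitz_on_def
  proof
    fix x assume "x \<in> F"
    then obtain r L where "r > 0" "L-lipschitz_on (cball x r \<inter> C) V"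
      using V_locally_lipschitz F unfolding locally_lipschitz_on_def by blast
    moreover from this have "L-lipschitz_on (cball x r \<inter> F) V"
      using F by (auto intro: lipschitz_on_subset)
    ultimately show "\<exists>r>0. \<exists>L. L-lipschitz_on (cball x r \<inter> F) V" by blast
  qed
  fix p assume "p \<in> F"
  then have "p \<in> C" using F by simp
  then obtain \<rho> \<delta> where \<rho>: "\<rho> > 0" "\<delta> > 0" and ex: "\<And>q. q \<in> ball p \<rho> \<Longrightarrow> \<exists>\<phi>. \<phi> 0 = q \<and>
    (\<forall>t\<in>{-\<delta><..<\<delta>}. \<phi> t \<in> C \<and> (\<phi> has_vector_derivative - V (\<phi> t)) (at t))"
    using picard_local[OF C(1) V_locally_lipschitz, of p] by auto
  have "\<exists>\<phi>. \<phi> 0 = q \<and>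
    (\<forall>t\<in>{-\<delta><..<\<delta>}. \<phi> t \<in> F \<and> (\<phi> has_vector_derivative - V (\<phi> t)) (at t))"
    if q: "q \<in> ball p \<rho> \<inter> F" for q
  proof -
    obtain \<phi> where \<phi>: "\<phi> 0 = q"
      "\<And>t. t \<in> {-\<delta><..<\<delta>} \<Longrightarrow> \<phi> t \<in> C"
      "\<And>t. t \<in> {-\<delta><..<\<delta>} \<Longrightarrow> (\<phi> has_vector_derivative - V (\<phi> t)) (at t)"
      using ex[of q] q by blast
    have "\<phi> t \<in> F" if t: "t \<in> {-\<delta><..<\<delta>}" for t
    proof -
      have "norm (A *v \<phi> t - A *v \<phi> 0) \<le> 0 * \<bar>t - 0\<bar>"
      proof (rule norm_diff_le_vector_derivative[where S = "{-\<delta><..<\<delta>}" and \<phi>' = "\<lambda>_. 0"])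
        fix s assume s: "s \<in> {-\<delta><..<\<delta>}"
        have "((\<lambda>s. A *v \<phi> s) has_vector_derivative A *v (- V (\<phi> s))) (at s)"
          by (rule bounded_linear.has_vector_derivative[OF matrix_vector_mul_bounded_linear \<phi>(3)[OF s]])
        moreover have "A *v (- V (\<phi> s)) = 0"
          using V_tangent[OF \<phi>(2)[OF s]] by (metis linear_neg matrix_vector_mul_linear neg_0_equal_iff_equal)
        ultimately show "((\<lambda>s. A *v \<phi> s) has_vector_derivative 0) (at s)" by simp
      qed (use t \<rho> in auto)
      then show ?thesis using \<phi>(1) \<phi>(2)[OF t] q by (simp add: F affine_slice_def)
    qed
    then show ?thesis using \<phi> by blast
  qed
  then show "\<exists>\<rho>>0. \<exists>\<delta>>0. \<forall>q\<in>ball p \<rho> \<inter> F. \<exists>\<phi>. \<phi> 0 = q \<and>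
      (\<forall>t\<in>{-\<delta><..<\<delta>}. \<phi> t \<in> F \<and> (\<phi> has_vector_derivative - V (\<phi> t)) (at t))"
    using \<rho> by blast
qed

end

lemma antimono_bounded_below_tendsto:
  fixes g :: "real \<Rightarrow> real"
  assumes mono: "\<And>s t. a \<le> s \<Longrightarrow> s \<le> t \<Longrightarrow> g t \<le> g s" and bd: "\<And>t. a \<le> t \<Longrightarrow> m \<le> g t"
  shows "\<exists>l. (g \<longlongrightarrow> l) at_top"
proof -
  define l where "l = (INF t\<in>{a..}. g t)"
  have bdd: "bdd_below (g ` {a..})" using bd by (auto intro!: bdd_belowI2)
  have "(g \<longlongrightarrow> l) at_top"
  proof (rule order_tendstoI)
    fix c assume "c < l"
    moreover have "l \<le> g t" if "a \<le> t" for t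
      unfolding l_def by (rule cINF_lower[OF bdd]) (use that in auto)
    ultimately show "\<forall>\<^sub>F t in at_top. c < g t"
      unfolding eventually_at_top_linorder by (intro exI[of _ a]) (auto intro: less_le_trans)
  next
    fix c assume "l < c"
    then obtain s where "a \<le> s" "g s < c"
      unfolding l_def by (subst (asm) cINF_less_iff[OF _ bdd]) auto
    then show "\<forall>\<^sub>F t in at_top. g t < c"
      unfolding eventually_at_top_linorder using mono le_less_trans by (intro exI[of _ s]) blast
  qed
  then show ?thesis ..
qed

section \<open>Dissipation and Bregman identities along a solution\<close>

locale hessian_flow_solution = hessian_flow A b C F f h
  for A :: "real^'n^'m" and b C F f h +
  fixes x0 Tm TM x
  assumes sol: "ivp_solution (riem_grad A h f) F x0 Tm TM x"
begin

lemma in_F: "t \<in> einterval Tm TM \<Longrightarrow> x t \<in> F"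
  and in_C: "t \<in> einterval Tm TM \<Longrightarrow> x t \<in> C"
  and deriv: "t \<in> einterval Tm TM \<Longrightarrow> (x has_vector_derivative - V (x t)) (at t)"
  using sol F by (auto simp: ivp_solution_def)

lemma A_diff: "A *v (u - v) = 0" if "A *v u = b" "v \<in> F" for u v
  using that F by (simp add: affine_slice_def matrix_vector_mult_diff_distrib)

lemma x_0: "x 0 = x0" and zero_in: "0 \<in> einterval Tm TM"
  using sol by (auto simp: ivp_solution_def einterval_iff zero_ereal_def)

lemma einterval_between: "s \<in> einterval Tm TM \<Longrightarrow> t \<in> einterval Tm TM \<Longrightarrow> s \<le> u \<Longrightarrow> u \<le> t
    \<Longrightarrow> u \<in> einterval Tm TM"
  unfolding einterval_iff by (meson ereal_less_eq(3) le_less_trans less_le_trans)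

text \<open>The squared speed in the Riemannian metric, which is also the rate at which f is
  dissipated.\<close>

definition energy where "energy t = (H (x t) *v V (x t)) \<bullet> V (x t)"

lemma energy_nonneg: "t \<in> einterval Tm TM \<Longrightarrow> 0 \<le> energy t"
  unfolding energy_def using H_nonneg in_C by blast

lemma f_deriv:
  assumes "t \<in> einterval Tm TM"
  shows "((\<lambda>t. f (x t)) has_real_derivative - energy t) (at t)"
  using has_real_derivative_along[OF f_differentiable deriv[OF assms]]
    V_gradient[OF in_C[OF assms] V_tangent[OF in_C[OF assms]]] by (simp add: energy_def)

lemma f_decreasing:
  assumes "s \<in> einterval Tm TM" "t \<in> einterval Tm TM" "s \<le> t"
  shows "f (x t) \<le> f (x s)"
  using \<open>s \<le> t\<close>
proof (rule DERIV_nonpos_imp_nonincreasing)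
  fix u assume "s \<le> u" "u \<le> t"
  then have u: "u \<in> einterval Tm TM" using einterval_between assms by blast
  show "\<exists>y. ((\<lambda>t. f (x t)) has_real_derivative y) (at u) \<and> y \<le> 0"
    using f_deriv[OF u] energy_nonneg[OF u] by auto
qed

lemma grad_h_deriv:
  assumes "t \<in> einterval Tm TM"
  shows "((\<lambda>t. grad (rpart h) (x t)) has_vector_derivative - (H (x t) *v V (x t))) (at t)"
proof -
  have "H (x t) *v (- V (x t)) = - (H (x t) *v V (x t))"
    by (rule linear_neg[OF matrix_vector_mul_linear])
  then show ?thesis
    using grad_has_vector_derivative_along[OF h_differentiable(2)[OF in_C[OF assms]] deriv[OF assms]]
    by simp
qed

text \<open>The two terms in \<open>grad (rpart h) (x t)\<close> cancel, and what remains pairs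
  \<open>H V\<close> with the tangent vector \<open>a - x t\<close>. The value of h at
  \<open>a\<close> enters only as a constant, so \<open>a\<close> may lie on the boundary of
  \<open>C\<close>.\<close>

lemma bregman_deriv:
  assumes t: "t \<in> einterval Tm TM" and a: "A *v a = b"
  shows "((\<lambda>t. bregman h a (x t)) has_real_derivative grad f (x t) \<bullet> (a - x t)) (at t)"
proof -
  let ?g = "grad (rpart h)"
  have 1: "((\<lambda>t. rpart h (x t)) has_real_derivative ?g (x t) \<bullet> - V (x t)) (at t)"
    by (rule has_real_derivative_along[OF h_differentiable(1)[OF in_C[OF t]] deriv[OF t]])
  have "((\<lambda>t. a - x t) has_vector_derivative V (x t)) (at t)"
    using deriv[OF t] by (auto intro!: derivative_eq_intros)
  from has_derivative_inner[OF grad_h_deriv[OF t, unfolded has_vector_derivative_def]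
      this[unfolded has_vector_derivative_def]]
  have 2: "((\<lambda>t. ?g (x t) \<bullet> (a - x t)) has_real_derivative
      ?g (x t) \<bullet> V (x t) - (H (x t) *v V (x t)) \<bullet> (a - x t)) (at t)"
    unfolding has_field_derivative_def
    by (rule has_derivative_eq_rhs) (simp add: fun_eq_iff algebra_simps)
  have "(H (x t) *v V (x t)) \<bullet> (a - x t) = grad f (x t) \<bullet> (a - x t)"
    by (rule V_gradient[OF in_C[OF t] A_diff[OF a in_F[OF t]]])
  then show ?thesis
    unfolding bregman_def using 1 2 by (auto intro!: derivative_eq_intros)
qed

lemma zero_le_in: "TM = ereal T \<Longrightarrow> 0 \<le> t \<Longrightarrow> t < T \<Longrightarrow> t \<in> einterval Tm TM"
  using zero_in by (auto simp: einterval_iff intro: less_le_trans)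

section \<open>Bounded orbits do not escape in finite time\<close>

text \<open>\<open>\<nabla>h(x(t))\<close> moves with bounded velocity along \<open>ker A\<close>, and monotonicity of
  \<open>\<nabla>h\<close> on a ball around \<open>x0\<close> controls the transversal directions.\<close>

lemma grad_h_bounded:
  assumes T: "TM = ereal T" and bd: "\<And>t. 0 \<le> t \<Longrightarrow> t < T \<Longrightarrow> norm (x t) \<le> B"
  obtains M where "\<And>t. 0 \<le> t \<Longrightarrow> t < T \<Longrightarrow> norm (grad (rpart h) (x t)) \<le> M"
proof -
  let ?g = "grad (rpart h)"
  have T0: "0 < T" using zero_in by (simp add: T einterval_iff)
  have "continuous_on (cball 0 B) (grad f)"
    using f(1) continuous_on_subset unfolding C1_on_def by blast
  then have "bounded (grad f ` cball 0 B)"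
    by (intro compact_imp_bounded compact_continuous_image) auto
  then obtain G where G: "G > 0" "\<And>y. y \<in> cball 0 B \<Longrightarrow> norm (grad f y) \<le> G"
    by (auto simp: bounded_pos)
  have x0: "x0 \<in> F" "x0 \<in> C" using in_F[OF zero_in] in_C[OF zero_in] by (simp_all add: x_0)
  obtain e where e: "e > 0" "cball x0 e \<subseteq> C" using C(1) x0(2) open_contains_cball by blast
  have "continuous_on (cball x0 e) ?g"
    using h_C2 e(2) continuous_on_subset unfolding C2_on_def C1_on_def by blast
  then have "bounded (?g ` cball x0 e)"
    by (intro compact_imp_bounded compact_continuous_image) auto
  then obtain M1 where M1: "M1 > 0" "\<And>y. y \<in> cball x0 e \<Longrightarrow> norm (?g y) \<le> M1"
    by (auto simp: bounded_pos)
  \<comment> \<open>The factor \<open>T\<close> bounds the time over which a velocity of at most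
    \<open>G * norm u\<close> acts.\<close>
  have tan: "\<bar>(?g (x t) - ?g x0) \<bullet> u\<bar> \<le> (T * G) * norm u"
    if t: "0 \<le> t" "t < T" and u: "A *v u = 0" for t u
  proof -
    have "norm (?g (x t) \<bullet> u - ?g (x 0) \<bullet> u) \<le> (G * norm u) * \<bar>t - 0\<bar>"
    proof (rule norm_diff_le_vector_derivative[where S = "{0..<T}" and \<phi>' = "\<lambda>s. - (grad f (x s) \<bullet> u)"])
      fix s assume "s \<in> {0..<T}"
      then have s: "0 \<le> s" "s < T" and sI: "s \<in> einterval Tm TM" using zero_le_in[OF T] by auto
      have "((\<lambda>s. ?g (x s) \<bullet> u) has_vector_derivative (- (H (x s) *v V (x s))) \<bullet> u) (at s)"
        by (rule bounded_linear.has_vector_derivative[OF bounded_linear_inner_left grad_h_deriv[OF sI]])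
      then show "((\<lambda>s. ?g (x s) \<bullet> u) has_vector_derivative - (grad f (x s) \<bullet> u)) (at s)"
        using V_gradient[OF in_C[OF sI] u] by simp
      have "norm (- (grad f (x s) \<bullet> u)) \<le> norm (grad f (x s)) * norm u"
        using Cauchy_Schwarz_ineq2 by simp
      also have "\<dots> \<le> G * norm u" using G(2)[of "x s"] bd[OF s] by (intro mult_right_mono) auto
      finally show "norm (- (grad f (x s) \<bullet> u)) \<le> G * norm u" .
    qed (use t T0 in auto)
    also have "\<dots> \<le> (G * norm u) * T" using t G by (intro mult_left_mono) auto
    finally show ?thesis by (simp add: x_0 inner_diff_left mult_ac)
  qed
  define N where "N = norm x0 + B"
  \<comment> \<open>Obtained by dividing the final inequality by \<open>e\<close>: the first summand
    bounds the gradient at the test point \<open>y\<close> paired with \<open>y - x t\<close>, the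
    second bounds \<open>- (g \<bullet> (x0 - x t))\<close>, where \<open>x0 - x t\<close> is
    tangent.\<close>
  define M where "M = (M1 * (N + e) + (M1 + T * G) * N) / e"
  have "norm (?g (x t)) \<le> M" if t: "0 \<le> t" "t < T" for t
  proof (cases "?g (x t) = 0")
    case True
    have "norm (x 0) \<le> B" using bd T0 by simp
    then have "N \<ge> 0" using norm_ge_zero[of x0] norm_ge_zero[of "x 0"] unfolding N_def by linarith
    then show ?thesis using True M1 G e T0 by (simp add: M_def)
  next
    case False
    define g where "g = ?g (x t)"
    \<comment> \<open>The point of the ball farthest in the direction of \<open>g\<close>:
      monotonicity between \<open>y\<close> and \<open>x t\<close> then produces the full term
      \<open>e * norm g\<close>.\<close>
    define y where "y = x0 + (e / norm g) *\<^sub>R g"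
    have tI: "t \<in> einterval Tm TM" using zero_le_in[OF T t] .
    have g0: "norm g > 0" using False by (simp add: g_def)
    have y: "y \<in> cball x0 e" using e g0 by (simp add: y_def dist_norm)
    have gy: "g \<bullet> (y - x0) = e * norm g"
      using g0 by (simp add: y_def dot_square_norm power2_eq_square)
    have nx: "norm (x0 - x t) \<le> N" using norm_triangle_ineq4[of x0 "x t"] bd[OF t] by (simp add: N_def)
    have ny: "norm (y - x t) \<le> N + e"
      using norm_triangle_ineq[of "y - x0" "x0 - x t"] y nx by (simp add: dist_norm norm_minus_commute)
    have "0 \<le> (?g y - g) \<bullet> (y - x t)"
      unfolding g_def
      by (rule grad_monotone[OF C(2) h_differentiable(2) H_nonneg]) (use y e in_C[OF tI] in auto)
    then have "g \<bullet> (y - x0) + g \<bullet> (x0 - x t) \<le> ?g y \<bullet> (y - x t)"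
      by (simp add: inner_diff_left inner_diff_right)
    also have "\<dots> \<le> norm (?g y) * norm (y - x t)" by (rule norm_cauchy_schwarz)
    also have "\<dots> \<le> M1 * (N + e)" using M1(2)[OF y] ny M1(1) by (intro mult_mono) auto
    finally have 1: "e * norm g + g \<bullet> (x0 - x t) \<le> M1 * (N + e)" by (simp add: gy)
    have "A *v x0 = b" using x0 F by (simp add: affine_slice_def)
    then have "\<bar>(g - ?g x0) \<bullet> (x0 - x t)\<bar> \<le> (T * G) * norm (x0 - x t)"
      unfolding g_def by (intro tan[OF t] A_diff in_F[OF tI])
    moreover have "\<bar>?g x0 \<bullet> (x0 - x t)\<bar> \<le> M1 * norm (x0 - x t)"
      using Cauchy_Schwarz_ineq2[of "?g x0" "x0 - x t"] mult_right_mono[OF M1(2)[of x0], of "norm (x0 - x t)"] e(1)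
      by simp
    moreover have "(M1 + T * G) * norm (x0 - x t) \<le> (M1 + T * G) * N"
      using nx M1 G T0 by (intro mult_left_mono) auto
    ultimately have "- (g \<bullet> (x0 - x t)) \<le> (M1 + T * G) * N"
      by (simp add: inner_diff_left algebra_simps)
    then have "e * norm g \<le> M1 * (N + e) + (M1 + T * G) * N" using 1 by simp
    then show ?thesis using e(1) by (simp add: M_def g_def field_simps)
  qed
  then show ?thesis using that by blast
qed

text \<open>A bounded orbit cannot approach the boundary of \<open>C\<close> in finite time, since \<open>|\<nabla>h|\<close> would blow up.\<close>

lemma bounded_maximal_imp_infinite:
  assumes max: "maximal_solution V F x0 Tm TM x" and T: "TM = ereal T"
    and bd: "bounded (x ` {0..<T})"
  shows False
proof -
  have T0: "0 < T" using zero_in by (simp add: T einterval_iff)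
  obtain B where "\<forall>t\<in>{0..<T}. norm (x t) \<le> B"
    using bd by (auto simp: bounded_iff)
  then have B: "norm (x t) \<le> B" if "0 \<le> t" "t < T" for t using that by simp
  obtain M where M: "\<And>t. 0 \<le> t \<Longrightarrow> t < T \<Longrightarrow> norm (grad (rpart h) (x t)) \<le> M"
    using grad_h_bounded[OF T B] by blast
  define s where "s = (\<lambda>j. T - T * inverse (real (Suc j)))"
  have s: "0 \<le> s j" "s j < T" for j
    using T0 by (auto simp: s_def field_simps)
  have "s \<longlonglongrightarrow> T - T * 0"
    unfolding s_def by (intro tendsto_intros LIMSEQ_inverse_real_of_nat)
  then have sT: "s \<longlonglongrightarrow> T" by simp
  have "compact (cball (0::real^'n) B)" by simp
  moreover have "\<forall>j. x (s j) \<in> cball 0 B" using B s by simp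
  ultimately obtain p r where r: "strict_mono r" and lim: "((\<lambda>j. x (s j)) \<circ> r) \<longlonglongrightarrow> p"
    unfolding compact_def by metis
  have sr: "(s \<circ> r) \<longlonglongrightarrow> T" using LIMSEQ_subseq_LIMSEQ[OF sT r] .
  have lim': "(\<lambda>j. x ((s \<circ> r) j)) \<longlonglongrightarrow> p" using lim by (simp add: o_def)
  have xI: "(s \<circ> r) j \<in> einterval Tm TM" for j using zero_le_in[OF T] s by simp
  have clos: "p \<in> closure C"
    using closed_sequentially[OF closed_closure _ lim'] in_C[OF xI] closure_subset by blast
  have "closed (affine_slice A b)"
    unfolding affine_slice_def
    by (intro closed_Collect_eq continuous_intros linear_continuous_on matrix_vector_mul_bounded_linear)
  then have pA: "p \<in> affine_slice A b"
    using closed_sequentially[OF _ _ lim'] in_F[OF xI] F by blast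
  have "p \<in> C"
  proof (rule ccontr)
    assume "p \<notin> C"
    \<comment> \<open>The frontier of the domain is its closure without its interior
      \<open>C\<close>, so outside \<open>C\<close> only membership in the closure is left to
      check.\<close>
    have "closure C \<subseteq> closure (eff_dom h)"
      using h_dom by (metis closure_mono interior_subset)
    then have "p \<in> frontier (eff_dom h)"
      using \<open>p \<notin> C\<close> clos h_dom by (auto simp: frontier_def)
    then have "(\<forall>j. x ((s \<circ> r) j) \<in> C) \<and> (\<lambda>j. x ((s \<circ> r) j)) \<longlonglongrightarrow> p \<and> p \<in> frontier (eff_dom h)"
      using lim' in_C[OF xI] by blast
    then have "filterlim (\<lambda>j. norm (grad (rpart h) (x ((s \<circ> r) j)))) at_top sequentially"
      using h_smooth[unfolded essentially_smooth_def h_dom, THEN conjunct2, rule_format,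
          of "\<lambda>j. x ((s \<circ> r) j)" p] by blast
    then have "\<forall>\<^sub>F j in sequentially. M + 1 \<le> norm (grad (rpart h) (x ((s \<circ> r) j)))"
      by (simp add: filterlim_at_top)
    then obtain j where "M + 1 \<le> norm (grad (rpart h) (x ((s \<circ> r) j)))"
      by (auto dest: eventually_happens)
    then show False using M[OF s] by (metis add_le_same_cancel1 comp_apply not_one_le_zero order_trans)
  qed
  then have "p \<in> F" using pA F by simp
  then show False
    using maximal_solution_no_cluster_point[OF max[unfolded T], of "s \<circ> r" p] s sr lim' by simp
qed

section \<open>Boundedness of the orbit under each of the three conditions\<close>

lemma bounded_if_level_bounded:
  assumes T: "TM = ereal T" and "bounded {y \<in> closure F. f y \<le> f x0}"
  shows "bounded (x ` {0..<T})"
proof (rule bounded_subset[OF assms(2)])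
  show "x ` {0..<T} \<subseteq> {y \<in> closure F. f y \<le> f x0}"
  proof clarsimp
    fix t assume "0 \<le> t" "t < T"
    then have t: "t \<in> einterval Tm TM" "0 \<le> t" using zero_le_in[OF T] by auto
    show "x t \<in> closure F \<and> f (x t) \<le> f x0"
      using in_F[OF t(1)] closure_subset f_decreasing[OF zero_in t] x_0 by auto
  qed
qed

text \<open>Since \<open>f a \<le> f (x u)\<close>, quasi-convexity gives the derivative in
  \<open>bregman_deriv\<close> the right sign. The minimizer \<open>a\<close> is only compared with
  points of \<open>F\<close> and need not belong to \<open>F\<close>.\<close>

lemma bounded_if_bregman_bounded:
  assumes T: "TM = ereal T" and a: "A *v a = b" "\<And>y. y \<in> F \<Longrightarrow> f a \<le> f y"
    and qc: "quasi_convex f" and bd: "\<And>\<gamma>. bounded {y \<in> F. bregman h a y \<le> \<gamma>}"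
  shows "bounded (x ` {0..<T})"
proof (rule bounded_subset[OF bd])
  show "x ` {0..<T} \<subseteq> {y \<in> F. bregman h a y \<le> bregman h a x0}"
  proof clarsimp
    fix t assume t: "0 \<le> t" "t < T"
    have "bregman h a (x t) \<le> bregman h a (x 0)"
    proof (rule DERIV_nonpos_imp_nonincreasing[OF t(1)])
      fix u assume "0 \<le> u" "u \<le> t"
      then have u: "u \<in> einterval Tm TM" using zero_le_in[OF T] t by simp
      have "grad f (x u) \<bullet> (a - x u) \<le> 0"
        by (rule quasi_convex_grad_nonpos[OF qc f_differentiable a(2)[OF in_F[OF u]]])
      then show "\<exists>y. ((\<lambda>t. bregman h a (x t)) has_real_derivative y) (at u) \<and> y \<le> 0"
        using bregman_deriv[OF u a(1)] by blast
    qed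
    then show "x t \<in> F \<and> bregman h a (x t) \<le> bregman h a x0"
      using in_F[OF zero_le_in[OF T t]] x_0 by simp
  qed
qed

text \<open>Gronwall's lemma for \<open>\<surd>(1 + |x|\<^sup>2) + (f(x) - m) / 2\<close>, using
  \<open>|x'| \<le> (K|x| + L + energy) / 2\<close> and \<open>(f(x))' = - energy\<close>.\<close>

lemma bounded_if_linear_growth:
  assumes T: "TM = ereal T" and K: "K \<ge> 0"
    and growth: "\<And>y. y \<in> C \<Longrightarrow> onorm ((*v) (matrix_inv (H y))) \<le> K * norm y + L"
    and m: "\<And>y. y \<in> F \<Longrightarrow> m \<le> f y"
  shows "bounded (x ` {0..<T})"
proof -
  \<comment> \<open>\<open>L\<close> may be negative, whereas \<open>sym_pos_def_norm_le\<close>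
    needs a strictly positive bound.\<close>
  define L' where "L' = \<bar>L\<bar> + 1"
  \<comment> \<open>A smooth substitute for the norm, which is not differentiable at the
    origin.\<close>
  define q where "q = (\<lambda>t. sqrt (1 + x t \<bullet> x t))"
  define \<psi> where "\<psi> = (\<lambda>t. q t + (f (x t) - m) / 2)"
  define \<psi>' where "\<psi>' = (\<lambda>t. (x t \<bullet> (- V (x t))) / q t - energy t / 2)"
  have q: "norm (x t) \<le> q t" "0 < q t" for t
  proof -
    show "norm (x t) \<le> q t" unfolding q_def norm_eq_sqrt_inner by simp
    have "0 < 1 + x t \<bullet> x t" by (simp add: add_pos_nonneg)
    then show "0 < q t" unfolding q_def by simp
  qed
  have speed: "norm (V (x t)) \<le> (K * norm (x t) + L' + energy t) / 2" if t: "t \<in> einterval Tm TM" for t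
  proof -
    let ?l = "K * norm (x t) + L'"
    have l: "?l > 0" using K by (simp add: L'_def add_nonneg_pos)
    have "onorm ((*v) (matrix_inv (H (x t)))) \<le> ?l" using growth[OF in_C[OF t]] by (simp add: L'_def)
    from sym_pos_def_norm_le[OF h_pos[OF in_C[OF t]] this l]
    have "(norm (V (x t)))\<^sup>2 \<le> ?l * energy t" by (simp add: energy_def)
    \<comment> \<open>The arithmetic-geometric mean inequality makes \<open>energy\<close> appear
      linearly with factor 1/2, so that the term \<open>- energy t / 2\<close> of
      \<open>\<psi>'\<close> cancels it exactly.\<close>
    moreover have "4 * (?l * energy t) \<le> (?l + energy t)\<^sup>2"
      using zero_le_power2[of "?l - energy t"] by (simp add: power2_eq_square algebra_simps)
    ultimately have "(2 * norm (V (x t)))\<^sup>2 \<le> (?l + energy t)\<^sup>2"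
      by (simp add: power_mult_distrib)
    then have "2 * norm (V (x t)) \<le> ?l + energy t"
      by (rule power2_le_imp_le) (use l energy_nonneg[OF t] in simp)
    then show ?thesis by simp
  qed
  have deriv_\<psi>: "(\<psi> has_real_derivative \<psi>' t) (at t)" if t: "t \<in> einterval Tm TM" for t
  proof -
    have d: "(x has_derivative (\<lambda>h. h *\<^sub>R (- V (x t)))) (at t)"
      using deriv[OF t] by (simp add: has_vector_derivative_def)
    have "((\<lambda>t. x t \<bullet> x t) has_real_derivative 2 * (x t \<bullet> (- V (x t)))) (at t)"
      unfolding has_field_derivative_def
      by (rule has_derivative_eq_rhs[OF has_derivative_inner[OF d d]])
        (simp add: fun_eq_iff inner_commute algebra_simps)
    then have "(q has_real_derivative (x t \<bullet> (- V (x t))) / q t) (at t)"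
      unfolding q_def using q(2)[of t, unfolded q_def]
      by (auto intro!: derivative_eq_intros simp: field_simps)
    then show ?thesis
      unfolding \<psi>_def \<psi>'_def using f_deriv[OF t] by (auto intro!: derivative_eq_intros)
  qed
  have norm_le_\<psi>: "norm (x t) \<le> \<psi> t" if t: "t \<in> einterval Tm TM" for t
    unfolding \<psi>_def by (rule add_increasing2) (use q(1)[of t] m[OF in_F[OF t]] in auto)
  have bound: "\<psi>' t \<le> K / 2 * \<psi> t + L' / 2" if t: "t \<in> einterval Tm TM" for t
  proof -
    have "x t \<bullet> (- V (x t)) \<le> norm (x t) * norm (V (x t))"
      using norm_cauchy_schwarz[of "x t" "- V (x t)"] by simp
    also have "\<dots> \<le> q t * norm (V (x t))" by (intro mult_right_mono q) simp
    finally have "(x t \<bullet> (- V (x t))) / q t \<le> norm (V (x t))"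
      using q(2)[of t] by (simp add: field_simps)
    then have "\<psi>' t \<le> (K * norm (x t) + L') / 2"
      using speed[OF t] by (simp add: \<psi>'_def field_simps)
    moreover have "norm (x t) \<le> \<psi> t" using norm_le_\<psi>[OF t] .
    then have "K * norm (x t) \<le> K * \<psi> t" using K by (rule mult_left_mono)
    ultimately show ?thesis by (simp add: field_simps)
  qed
  have "norm (x t) \<le> exp (K / 2 * T) * (\<bar>\<psi> 0\<bar> + L' / 2 * T)" if t: "0 \<le> t" "t < T" for t
  proof -
    \<comment> \<open>Subtracting the inhomogeneous term as \<open>L' / 2 * t\<close>, rather than
      integrating it against the weight, avoids a division by \<open>K\<close>, which may be
      0.\<close>
    have "exp (- (K / 2) * t) * \<psi> t - L' / 2 * t \<le> exp (- (K / 2) * 0) * \<psi> 0 - L' / 2 * 0"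
    proof (rule DERIV_nonpos_imp_nonincreasing[OF t(1)])
      fix u assume u: "0 \<le> u" "u \<le> t"
      then have uI: "u \<in> einterval Tm TM" using zero_le_in[OF T] t by simp
      have D: "((\<lambda>u. exp (- (K / 2) * u) * \<psi> u - L' / 2 * u) has_real_derivative
          exp (- (K / 2) * u) * (\<psi>' u - K / 2 * \<psi> u) - L' / 2) (at u)"
        by (auto intro!: derivative_eq_intros deriv_\<psi>[OF uI] simp: algebra_simps)
      have "exp (- (K / 2) * u) * (\<psi>' u - K / 2 * \<psi> u) \<le> exp (- (K / 2) * u) * (L' / 2)"
        using bound[OF uI] by (intro mult_left_mono) auto
      moreover have "exp (- (K / 2) * u) * (L' / 2) \<le> 1 * (L' / 2)"
        using K u by (intro mult_right_mono) (auto simp: L'_def)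
      ultimately have "exp (- (K / 2) * u) * (\<psi>' u - K / 2 * \<psi> u) - L' / 2 \<le> 0" by linarith
      with D show "\<exists>z. ((\<lambda>u. exp (- (K / 2) * u) * \<psi> u - L' / 2 * u) has_real_derivative z) (at u)
          \<and> z \<le> 0"
        by blast
    qed
    then have "exp (- (K / 2) * t) * \<psi> t \<le> \<psi> 0 + L' / 2 * t" by simp
    also have "\<dots> \<le> \<bar>\<psi> 0\<bar> + L' / 2 * T" using t by (intro add_mono mult_left_mono) (auto simp: L'_def)
    finally have "exp (K / 2 * t) * (exp (- (K / 2) * t) * \<psi> t) \<le> exp (K / 2 * t) * (\<bar>\<psi> 0\<bar> + L' / 2 * T)"
      by (intro mult_left_mono) auto
    also have "\<dots> \<le> exp (K / 2 * T) * (\<bar>\<psi> 0\<bar> + L' / 2 * T)"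
      using t K by (intro mult_right_mono) (auto simp: L'_def mult_left_mono)
    also have "exp (K / 2 * t) * (exp (- (K / 2) * t) * \<psi> t) = \<psi> t"
      by (simp add: mult.assoc[symmetric] mult_exp_exp)
    finally show ?thesis
      using norm_le_\<psi>[OF zero_le_in[OF T t]] by simp
  qed
  then show ?thesis unfolding bounded_iff by (auto intro!: exI)
qed

end

theorem theorem4p1:
  fixes A :: "real^'n^'m" and b :: "real^'m"
    and C F :: "(real^'n) set"
    and f :: "real^'n \<Rightarrow> real" and h :: "real^'n \<Rightarrow> ereal"
    and x0 :: "real^'n"
  assumes dims: "CARD('m) < CARD('n)"
    and full_rank: "rank A = CARD('m)"
    and b: "b \<in> range ((*v) A)"
    and C: "C \<noteq> {}" "open C" "convex C"
    and F: "F = C \<inter> affine_slice A b" "F \<noteq> {}"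
      "closure F = closure C \<inter> affine_slice A b"
    and f: "C1_on UNIV f" "locally_lipschitz_on UNIV (grad f)"
    and h: "Gamma0 h" "legendre_type h" "interior (eff_dom h) = C"
      "C2_on C (rpart h)"
      "\<forall>x\<in>C. sym_pos_def (hessian (rpart h) x)"
      "locally_lipschitz_on C (hessian (rpart h))"
    and x0: "x0 \<in> F"
    and WP:
      "bounded {y \<in> closure F. f y \<le> f x0}
       \<or> (eff_dom h = closure C
          \<and> (\<forall>a\<in>closure C. \<forall>\<gamma>::real. bounded {y \<in> F. bregman h a y \<le> \<gamma>})
          \<and> {z. is_arg_min f (\<lambda>y. y \<in> closure C \<and> A *v y = b) z} \<noteq> {}
          \<and> quasi_convex f)
       \<or> (\<exists>K\<ge>0. \<exists>L. \<forall>x\<in>C.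
            onorm ((*v) (matrix_inv (hessian (rpart h) x))) \<le> K * norm x + L)"
    and inf: "(INF y\<in>F. ereal (f y)) > -\<infinity>"
  shows "well_posed (riem_grad A h f) F x0 \<and>
    (\<forall>Tm TM x. maximal_solution (riem_grad A h f) F x0 Tm TM x \<longrightarrow>
       TM = \<infinity> \<and>
       antimono_on (einterval Tm TM) (\<lambda>t. f (x t)) \<and>
       (\<exists>l. ((\<lambda>t. f (x t)) \<longlongrightarrow> l) at_top))"
proof -
  interpret hessian_flow A b C F f h
    using full_rank C F f h by unfold_locales (auto simp: legendre_type_def)
  \<comment> \<open>Any real number below the infimum serves as a lower bound, so the infimum itself
    need not be converted to a real.\<close>
  obtain m where "-\<infinity> < ereal m" "ereal m < (INF y\<in>F. ereal (f y))"
    using ereal_dense2[OF inf] by blast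
  then have m: "m \<le> f y" if "y \<in> F" for y
    using INF_lower[OF that, of "\<lambda>y. ereal (f y)"] by (metis ereal_less_eq(3) less_imp_le order_trans)
  have main: "TM = \<infinity> \<and> antimono_on (einterval Tm TM) (\<lambda>t. f (x t)) \<and> (\<exists>l. ((\<lambda>t. f (x t)) \<longlongrightarrow> l) at_top)"
    if max: "maximal_solution V F x0 Tm TM x" for Tm TM x
  proof -
    interpret hessian_flow_solution A b C F f h x0 Tm TM x
      using max by unfold_locales (simp add: maximal_solution_def)
    have bdd: "bounded (x ` {0..<T})" if T: "TM = ereal T" for T
      using WP
    proof (elim disjE conjE exE bexE)
      assume "bounded {y \<in> closure F. f y \<le> f x0}"
      then show ?thesis by (rule bounded_if_level_bounded[OF T])
    next
      assume D: "\<forall>a\<in>closure C. \<forall>\<gamma>. bounded {y \<in> F. bregman h a y \<le> \<gamma>}"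
        and S: "{z. is_arg_min f (\<lambda>y. y \<in> closure C \<and> A *v y = b) z} \<noteq> {}"
        and qc: "quasi_convex f"
      from S obtain a where a: "a \<in> closure C" "A *v a = b"
        "\<And>y. y \<in> closure C \<Longrightarrow> A *v y = b \<Longrightarrow> f a \<le> f y"
        by (auto simp: is_arg_min_linorder)
      have "f a \<le> f y" if "y \<in> F" for y
        using a(3)[of y] that F(1) closure_subset[of C] by (auto simp: affine_slice_def)
      then show ?thesis using bounded_if_bregman_bounded[OF T a(2) _ qc] D a(1) by blast
    next
      fix K L assume "K \<ge> 0" "\<forall>x\<in>C. onorm ((*v) (matrix_inv (H x))) \<le> K * norm x + L"
      then show ?thesis using bounded_if_linear_growth[OF T _ _ m] by blast
    qed
    \<comment> \<open>A real \<open>TM\<close> contradicts boundedness of the orbit, and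
      \<open>-\<infinity>\<close> is impossible because 0 lies in the interval.\<close>
    have inf: "TM = \<infinity>"
      using bounded_maximal_imp_infinite[OF max _ bdd] zero_in
      by (cases TM) (auto simp: einterval_iff)
    have anti: "antimono_on (einterval Tm TM) (\<lambda>t. f (x t))"
      using f_decreasing by (auto intro!: monotone_onI)
    have I: "t \<in> einterval Tm TM" if "0 \<le> t" for t
      using zero_in that by (auto simp: inf einterval_iff intro: less_le_trans)
    have "\<exists>l. ((\<lambda>t. f (x t)) \<longlongrightarrow> l) at_top"
      by (rule antimono_bounded_below_tendsto[of 0 _ m]) (auto intro!: f_decreasing m in_F I)
    then show ?thesis using inf anti by blast
  qed
  obtain Tm TM x where "maximal_solution V F x0 Tm TM x"
    "\<And>Sm SM y. maximal_solution V F x0 Sm SM y \<Longrightarrow>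
      Sm = Tm \<and> SM = TM \<and> (\<forall>t\<in>einterval Tm TM. y t = x t)"
    using maximal_solution_exists_unique[OF x0] by metis
  then have "well_posed V F x0"
    unfolding well_posed_def using main by metis
  then show ?thesis using main by blast
qed

end
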